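(* The problem $\min\{C_c^{\max}(P) : P\in\mathcal{SP}(G)\}$ of finding a most closeness-central shortest path in a given graph $G$ is NP-hard.
   Context: $G=(V,E)$ is an unweighted, possibly directed, graph, assumed connected if undirected and weakly connected if directed; in a directed graph an undirected edge is understood as a pair of oppositely directed edges. A path is a finite sequence of distinct vertices in which consecutive vertices are adjacent (a single vertex is allowed); its length is its number of edges. $\mathcal{SP}(G)$ is the set of all shortest paths between all pairs of nodes of $G$. For vertices $u,v$, $d_{uv}$ is the length of a shortest path from $u$ to $v$ ($+\infty$ if there is none). For a path $P$ and a vertex $u$, $d(u,P)=\min\{d_{uv}: v\in P\}$, and the path closeness centrality (an inverse measure: larger values mean less central) is $C_c^{\max}(P)=\max\{d(u,P): u\in V\}$. *)

theory Defs
  imports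
    "Graph_Theory.Graph_Theory"
    "HOL-Library.Extended_Nat"
    "HOL-Library.Log_Nat"
    "HOL-Computational_Algebra.Polynomial"
begin

section \<open>Deterministic multi-tape Turing machines\<close>

datatype move = Left | Stay | Right

fun displacement :: "move \<Rightarrow> int" where
  "displacement Left = -1"
| "displacement Stay = 0"
| "displacement Right = 1"

text \<open>
  States and tape symbols are initial segments of the naturals. State 0 is the start state and
  state 1 the halting state; symbol 0 is the blank, symbols 1 and 2 are the bits. Given a state and
  the symbols under the heads, the transition function yields the new state and, for each tape, the
  symbol to write and the head movement.
\<close>

record tm =
  num_tapes :: nat
  num_symbols :: nat
  num_states :: nat
  trans :: "nat \<Rightarrow> nat list \<Rightarrow> nat \<times> (nat \<times> move) list"

definition wf_tm :: "tm \<Rightarrow> bool" where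
  "wf_tm M \<longleftrightarrow>
     num_tapes M \<ge> 1 \<and> num_symbols M \<ge> 3 \<and> num_states M \<ge> 2 \<and>
     (\<forall>q < num_states M. \<forall>ss. length ss = num_tapes M \<and> set ss \<subseteq> {..<num_symbols M} \<longrightarrow>
        fst (trans M q ss) < num_states M \<and>
        length (snd (trans M q ss)) = num_tapes M \<and>
        fst ` set (snd (trans M q ss)) \<subseteq> {..<num_symbols M})"

text \<open>A tape is infinite in both directions and is given by its head position and its contents.\<close>

type_synonym tape = "int \<times> (int \<Rightarrow> nat)"
type_synonym config = "nat \<times> tape list"

definition tm_step :: "tm \<Rightarrow> config \<Rightarrow> config" where
  "tm_step M = (\<lambda>(q, ts).
     if q = 1 then (q, ts)
     else let (q', acts) = trans M q (map (\<lambda>(h, c). c h) ts)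
          in (q', map2 (\<lambda>(h, c) (s, m). (h + displacement m, c(h := s))) ts acts))"

definition word_tape :: "bool list \<Rightarrow> int \<Rightarrow> nat" where
  "word_tape w i =
     (if 0 \<le> i \<and> i < int (length w) then if w ! nat i then 2 else 1 else 0)"

text \<open>The arguments are written on the first tapes, one per tape; all other tapes are blank.\<close>

definition tm_initial :: "tm \<Rightarrow> bool list list \<Rightarrow> config" where
  "tm_initial M ws =
     (0, map (\<lambda>i. (0, word_tape (if i < length ws then ws ! i else []))) [0..<num_tapes M])"

text \<open>
  The output is read from the last tape, which must be blank elsewhere. As halting configurations
  are fixed points of \<open>tm_step\<close>, the definition below says that \<open>M\<close> halts after at most
  \<open>t\<close> steps.
\<close>

definition tm_outputs_within :: "tm \<Rightarrow> bool list list \<Rightarrow> bool list \<Rightarrow> nat \<Rightarrow> bool" where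
  "tm_outputs_within M ws w t \<longleftrightarrow>
     (let (q, ts) = (tm_step M ^^ t) (tm_initial M ws)
      in q = 1 \<and> snd (last ts) = word_tape w)"

section \<open>Polynomial time, NP and NP-hardness\<close>

definition poly_time :: "nat \<Rightarrow> (bool list list \<Rightarrow> bool list) \<Rightarrow> bool" where
  "poly_time k f \<longleftrightarrow>
     (\<exists>M (p :: nat poly). wf_tm M \<and> k \<le> num_tapes M \<and>
        (\<forall>ws. length ws = k \<longrightarrow>
           tm_outputs_within M ws (f ws) (poly p (sum_list (map length ws)))))"

type_synonym language = "bool list set"

text \<open>Languages with a polynomial-time verifier for certificates of polynomial length.\<close>

definition NP :: "language set" where
  "NP = {L. \<exists>V (p :: nat poly).
           poly_time 2 (\<lambda>ws. [V (ws ! 0) (ws ! 1)]) \<and>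
           (\<forall>x. x \<in> L \<longleftrightarrow> (\<exists>u. length u \<le> poly p (length x) \<and> V x u))}"

definition poly_reducible :: "language \<Rightarrow> language \<Rightarrow> bool" (infix "\<le>\<^sub>p" 50) where
  "A \<le>\<^sub>p B \<longleftrightarrow> (\<exists>f. poly_time 1 (\<lambda>ws. f (ws ! 0)) \<and> (\<forall>x. x \<in> A \<longleftrightarrow> f x \<in> B))"

definition NP_hard :: "language \<Rightarrow> bool" where
  "NP_hard B \<longleftrightarrow> (\<forall>A \<in> NP. A \<le>\<^sub>p B)"

text \<open>
  A minimization problem consists of a set of instances, the feasible solutions of each instance and
  their costs. It is NP-hard if its decision version is: given an instance \<open>I\<close> and a threshold
  \<open>k\<close>, is there a feasible solution of cost at most \<open>k\<close>?
\<close>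

definition decision_version ::
  "('i \<Rightarrow> nat \<Rightarrow> bool list) \<Rightarrow> 'i set \<Rightarrow> ('i \<Rightarrow> 's set) \<Rightarrow> ('i \<Rightarrow> 's \<Rightarrow> enat) \<Rightarrow> language" where
  "decision_version encode instances feasible cost =
     {encode I k | I k. I \<in> instances \<and> (\<exists>S \<in> feasible I. cost I S \<le> enat k)}"

definition NP_hard_minimization ::
  "('i \<Rightarrow> nat \<Rightarrow> bool list) \<Rightarrow> 'i set \<Rightarrow> ('i \<Rightarrow> 's set) \<Rightarrow> ('i \<Rightarrow> 's \<Rightarrow> enat) \<Rightarrow> bool" where
  "NP_hard_minimization encode instances feasible cost \<longleftrightarrow>
     NP_hard (decision_version encode instances feasible cost)"

section \<open>Shortest paths and path closeness centrality\<close>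

definition vdist :: "'a pair_pre_digraph \<Rightarrow> 'a \<Rightarrow> 'a \<Rightarrow> enat" where
  "vdist G u v = (INF p \<in> {p. vpath p (with_proj G) \<and> hd p = u \<and> last p = v}. enat (vwalk_length p))"

definition shortest_paths :: "'a pair_pre_digraph \<Rightarrow> 'a list set" where
  "shortest_paths G =
     {p. vpath p (with_proj G) \<and> enat (vwalk_length p) = vdist G (hd p) (last p)}"

definition path_dist :: "'a pair_pre_digraph \<Rightarrow> 'a \<Rightarrow> 'a list \<Rightarrow> enat" where
  "path_dist G u P = (MIN v \<in> set P. vdist G u v)"

definition max_closeness :: "'a pair_pre_digraph \<Rightarrow> 'a list \<Rightarrow> enat" where
  "max_closeness G P = (MAX u \<in> pverts G. path_dist G u P)"

section \<open>Problem instances\<close>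

text \<open>
  Simple digraphs on the vertices \<open>0, \<dots>, n - 1\<close> that are (weakly) connected. The undirected graphs
  are the symmetric ones among them. Note that \<open>connected\<close> refers to the symmetric closure,
  and excludes the graph without vertices.
\<close>

definition weakly_connected_digraphs :: "nat pair_pre_digraph set" where
  "weakly_connected_digraphs =
     {G. pair_digraph G \<and> (\<exists>n. pverts G = {0..<n}) \<and> Digraph_Component.connected (with_proj G)}"

text \<open>
  The number of vertices in unary, the adjacency matrix row by row, and the threshold in binary
  with the least significant bit first.
\<close>

definition encode_instance :: "nat pair_pre_digraph \<Rightarrow> nat \<Rightarrow> bool list" where
  "encode_instance G k =
     (let n = card (pverts G)
      in replicate n True @ [False] @
         [(i, j) \<in> parcs G. i \<leftarrow> [0..<n], j \<leftarrow> [0..<n]] @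
         map (bit k) [0..<floorlog 2 k])"

end

theory Submission
  imports Defs
begin

text \<open>
  The tableau of a verifier's run is a choice of one cell content for every time and position,
  subject to clauses saying that one of some (place, content) pairs is chosen. Such a choice is a
  path: order the places linearly, put the possible contents of a place into one layer, and join
  every vertex to all vertices of the next layer, the last layer to a sink. A clause becomes a source
  whose out-neighbours are its literals. The sink and a clause on the first place force a path with
  eccentricity at most 1 to cross all layers; unchosen contents then are adjacent to the path anyway,
  and a clause vertex is within distance 1 exactly if the clause holds. All paths between two layers
  have the same length, so every choice is a shortest path, and the threshold is the constant 1.

  Adjacency only compares times and positions up to additive constants and looks up input bits. So a
  machine that uses head positions as unary counters writes the adjacency matrix in nested loops.
\<close>

section \<open>Counter programs and their Turing machines\<close>

text \<open>Hardness quantifies over all verifiers, so the reduction starts from an arbitrary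
  machine and turns its tableau into a graph directly, without an intermediate formula problem. What
  shapes the construction is that a Turing machine must print the matrix. Hence the graph is
  uniform: every time and position carries the same finite set of vertices, which depends on the
  machine only, and a clause that makes no sense somewhere is trivially true there instead of
  absent. A vertex number is a triple (time, position, kind) in mixed radix. Contents are stored
  relative to the heads, so a step is a function of four cells and no head marker is needed. With
  running time R the tableau has times 0 to R and positions 0 to 4R, offset 0 being at 2R. After
  time 0 the border positions are unconstrained; errors creep inwards one cell per step, and at time
  R the positions R to 3R are still right. They include the output cell, as a head travels at most
  R.\<close>

type_synonym store = "nat \<Rightarrow> nat"
type_synonym state = "store \<times> bool list"

datatype cmd =
    Skip
  | Inc nat
  | Dec nat
  | Emit bool
  | Seq cmd cmd (infixr ";;" 60)
  | Branch nat nat cmd cmd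
  | Loop nat nat cmd

text \<open>
  A register is the head position of a tape whose only nonblank symbol is the mark 3 in the cell
  standing for 0. Register 0 moves over the input instead: there the mark is in the cell to the left
  of the input, so value \<open>v\<close> reads the \<open>v\<close>-th input bit, counted from 1.
\<close>

definition head_symbol :: "bool list \<Rightarrow> nat \<Rightarrow> nat \<Rightarrow> nat" where
  "head_symbol x r v = (if v = 0 then 3 else if r = 0 then word_tape x (int v - 1) else 0)"

text \<open>The number counts compiled instructions, a test and a jump making the 2.
  \<open>Weaken\<close> turns it into an upper bound, so that all rounds of a loop can share one
  bound.\<close>

inductive runs :: "bool list \<Rightarrow> cmd \<Rightarrow> state \<Rightarrow> nat \<Rightarrow> state \<Rightarrow> bool" for x where
  Skip: "runs x Skip st 0 st"
| Inc: "runs x (Inc r) (s, w) 1 (s(r := Suc (s r)), w)"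
| Dec: "runs x (Dec r) (s, w) 1 (s(r := s r - 1), w)"
| Emit: "runs x (Emit b) (s, w) 1 (s, w @ [b])"
| Seq: "\<lbrakk>runs x c st t st'; runs x c' st' t' st''\<rbrakk> \<Longrightarrow> runs x (c ;; c') st (t + t') st''"
| BranchT: "\<lbrakk>head_symbol x r (fst st r) = a; runs x c st t st'\<rbrakk> \<Longrightarrow> runs x (Branch r a c c') st (t + 2) st'"
| BranchF: "\<lbrakk>head_symbol x r (fst st r) \<noteq> a; runs x c' st t st'\<rbrakk> \<Longrightarrow> runs x (Branch r a c c') st (t + 2) st'"
| LoopE: "head_symbol x r (fst st r) = a \<Longrightarrow> runs x (Loop r a c) st 1 st"
| LoopS: "\<lbrakk>head_symbol x r (fst st r) \<noteq> a; runs x c st t st'; runs x (Loop r a c) st' t' st''\<rbrakk>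
    \<Longrightarrow> runs x (Loop r a c) st (t + t' + 2) st''"
| Weaken: "\<lbrakk>runs x c st t st'; t \<le> t'\<rbrakk> \<Longrightarrow> runs x c st t' st'"

section \<open>Jump code and the compilation of programs\<close>

datatype instr = IInc nat | IDec nat | IEmit bool | IBranch nat nat nat nat

primrec csize :: "cmd \<Rightarrow> nat" where
  "csize Skip = 0"
| "csize (Inc r) = 1"
| "csize (Dec r) = 1"
| "csize (Emit b) = 1"
| "csize (c ;; c') = csize c + csize c'"
| "csize (Branch r a c c') = csize c + csize c' + 2"
| "csize (Loop r a c) = csize c + 2"

text \<open>Targets are absolute, \<open>l\<close> being the address of the first instruction. A
  branch with two equal targets is an unconditional jump; it nominally reads register 0, which, like
  the default for \<open>IEmit\<close>, explains \<open>insert 0\<close> in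
  \<open>iregister_compile\<close>.\<close>

primrec compile :: "nat \<Rightarrow> cmd \<Rightarrow> instr list" where
  "compile l Skip = []"
| "compile l (Inc r) = [IInc r]"
| "compile l (Dec r) = [IDec r]"
| "compile l (Emit b) = [IEmit b]"
| "compile l (c ;; c') = compile l c @ compile (l + csize c) c'"
| "compile l (Branch r a c c') =
     IBranch r a (l + 1) (l + csize c + 2) # compile (l + 1) c @
     IBranch 0 0 (l + csize c + csize c' + 2) (l + csize c + csize c' + 2) # compile (l + csize c + 2) c'"
| "compile l (Loop r a c) =
     IBranch r a (l + csize c + 2) (l + 1) # compile (l + 1) c @ [IBranch 0 0 l l]"

lemma length_compile [simp]: "length (compile l c) = csize c"
  by (induction c arbitrary: l) auto

primrec registers :: "cmd \<Rightarrow> nat set" where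
  "registers Skip = {}"
| "registers (Inc r) = {r}"
| "registers (Dec r) = {r}"
| "registers (Emit b) = {}"
| "registers (c ;; c') = registers c \<union> registers c'"
| "registers (Branch r a c c') = insert r (registers c \<union> registers c')"
| "registers (Loop r a c) = insert r (registers c)"

fun iregister :: "instr \<Rightarrow> nat" where
  "iregister (IInc r) = r"
| "iregister (IDec r) = r"
| "iregister (IEmit b) = 0"
| "iregister (IBranch r a l l') = r"

lemma iregister_compile: "i \<in> set (compile l c) \<Longrightarrow> iregister i \<in> insert 0 (registers c)"
proof (induction c arbitrary: l)
  case (Seq c c')
  from Seq.prems consider "i \<in> set (compile l c)" | "i \<in> set (compile (l + csize c) c')" by auto
  then show ?case using Seq.IH(1)[of l] Seq.IH(2)[of "l + csize c"] by cases auto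
next
  case (Branch r a c c')
  then show ?case by fastforce
next
  case (Loop r a c)
  then show ?case by fastforce
qed auto

fun istep :: "bool list \<Rightarrow> instr list \<Rightarrow> nat \<times> state \<Rightarrow> nat \<times> state" where
  "istep x P (l, s, w) =
     (if l < length P then
        case P ! l of
          IInc r \<Rightarrow> (l + 1, s(r := Suc (s r)), w)
        | IDec r \<Rightarrow> (l + 1, s(r := s r - 1), w)
        | IEmit b \<Rightarrow> (l + 1, s, w @ [b])
        | IBranch r a l1 l2 \<Rightarrow> (if head_symbol x r (s r) = a then l1 else l2, s, w)
      else (l, s, w))"

definition code_at :: "instr list \<Rightarrow> nat \<Rightarrow> instr list \<Rightarrow> bool" where
  "code_at P l Q \<longleftrightarrow> (\<exists>A B. P = A @ Q @ B \<and> length A = l)"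

lemma code_at_append: "code_at P l (Q @ R) \<longleftrightarrow> code_at P l Q \<and> code_at P (l + length Q) R"
proof
  assume "code_at P l (Q @ R)"
  then obtain A B where "P = A @ (Q @ R) @ B" "length A = l" unfolding code_at_def by blast
  then have "P = A @ Q @ (R @ B)" "P = (A @ Q) @ R @ B" "length (A @ Q) = l + length Q" by auto
  then show "code_at P l Q \<and> code_at P (l + length Q) R"
    using \<open>length A = l\<close> unfolding code_at_def by blast
next
  assume "code_at P l Q \<and> code_at P (l + length Q) R"
  then obtain A B A' B' where "P = A @ Q @ B" "length A = l" "P = A' @ R @ B'" "length A' = l + length Q"
    unfolding code_at_def by blast
  then have "A' = A @ Q"
    by (metis append.assoc append_eq_append_conv length_append)
  then show "code_at P l (Q @ R)"
    using \<open>P = A' @ R @ B'\<close> \<open>length A = l\<close> unfolding code_at_def by auto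
qed

lemma code_at_Cons: "code_at P l (i # Q) \<longleftrightarrow> l < length P \<and> P ! l = i \<and> code_at P (Suc l) Q"
proof -
  have "code_at P l (i # Q) \<longleftrightarrow> code_at P l [i] \<and> code_at P (Suc l) Q"
    using code_at_append[of P l "[i]" Q] by simp
  moreover have "code_at P l [i] \<longleftrightarrow> l < length P \<and> P ! l = i"
  proof
    show "code_at P l [i] \<Longrightarrow> l < length P \<and> P ! l = i"
      unfolding code_at_def by (auto simp: nth_append)
    show "l < length P \<and> P ! l = i \<Longrightarrow> code_at P l [i]"
      unfolding code_at_def
      by (intro exI[of _ "take l P"] exI[of _ "drop (Suc l) P"]) (auto simp: id_take_nth_drop[symmetric])
  qed
  ultimately show ?thesis by simp
qed

lemma funpow_trans: "(f ^^ m) a = b \<Longrightarrow> (f ^^ n) b = c \<Longrightarrow> (f ^^ (m + n)) a = c"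
  by (metis add.commute comp_apply funpow_add)

lemma funpow_one: "f a = b \<Longrightarrow> (f ^^ n) b = c \<Longrightarrow> (f ^^ Suc n) a = c"
  by (simp add: funpow_swap1)

text \<open>Induction on the run, because a loop recurs to itself. Only \<open>t' \<le> t\<close>
  can be claimed: \<open>Weaken\<close> loosens the bound, and \<open>BranchF\<close> is charged for
  a jump that only the other branch performs.\<close>

lemma compile_correct:
  assumes "runs x c st t st'" and "code_at P l (compile l c)"
  shows "\<exists>t' \<le> t. (istep x P ^^ t') (l, st) = (l + csize c, st')"
  using assms
proof (induction arbitrary: l)
  case (Skip st)
  then show ?case by (intro exI[of _ 0]) simp
next
  case (Inc r s w)
  then show ?case by (intro exI[of _ 1]) (simp add: code_at_Cons)
next
  case (Dec r s w)
  then show ?case by (intro exI[of _ 1]) (simp add: code_at_Cons)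
next
  case (Emit b s w)
  then show ?case by (intro exI[of _ 1]) (simp add: code_at_Cons)
next
  case (Seq c st t st' c' t' st'')
  obtain t1 where "t1 \<le> t" "(istep x P ^^ t1) (l, st) = (l + csize c, st')"
    using Seq.IH(1)[of l] Seq.prems by (auto simp: code_at_append)
  moreover obtain t2 where "t2 \<le> t'" "(istep x P ^^ t2) (l + csize c, st') = (l + csize c + csize c', st'')"
    using Seq.IH(2)[of "l + csize c"] Seq.prems by (auto simp: code_at_append)
  ultimately show ?case
    by (intro exI[of _ "t1 + t2"]) (auto intro: funpow_trans simp: add.assoc)
next
  case (BranchT r st a c t st' c')
  let ?f = "istep x P" and ?e = "l + csize c + csize c' + 2"
  obtain t1 where t1: "t1 \<le> t" "(?f ^^ t1) (l + 1, st) = (l + 1 + csize c, st')"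
    using BranchT.IH[of "l + 1"] BranchT.prems by (auto simp: code_at_append code_at_Cons)
  have a: "?f (l, st) = (l + 1, st)"
    using BranchT.prems BranchT.hyps(1) by (cases st) (auto simp: code_at_append code_at_Cons)
  have b: "?f (l + 1 + csize c, st') = (?e, st')"
    using BranchT.prems by (cases st') (auto simp: code_at_append code_at_Cons)
  have "(?f ^^ (Suc t1 + 1)) (l, st) = (?e, st')"
    by (rule funpow_trans[OF funpow_one[of ?f, OF a t1(2)]]) (simp add: b[simplified])
  then show ?case using t1(1) by (intro exI[of _ "Suc t1 + 1"]) (simp add: add_ac)
next
  case (BranchF r st a c' t st' c)
  let ?f = "istep x P" and ?e = "l + csize c + csize c' + 2"
  obtain t1 where t1: "t1 \<le> t" "(?f ^^ t1) (l + csize c + 2, st) = (?e, st')"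
    using BranchF.IH[of "l + csize c + 2"] BranchF.prems by (auto simp: code_at_append code_at_Cons add_ac)
  have a: "?f (l, st) = (l + csize c + 2, st)"
    using BranchF.prems BranchF.hyps(1) by (cases st) (auto simp: code_at_append code_at_Cons)
  have "(?f ^^ Suc t1) (l, st) = (?e, st')"
    by (rule funpow_one[OF a t1(2)])
  then show ?case using t1(1) by (intro exI[of _ "Suc t1"]) (simp add: add_ac)
next
  case (LoopE r st a c)
  then show ?case by (cases st) (auto intro!: exI[of _ 1] simp: code_at_Cons)
next
  case (LoopS r st a c t st' t' st'')
  let ?f = "istep x P"
  obtain t1 where t1: "t1 \<le> t" "(?f ^^ t1) (l + 1, st) = (l + 1 + csize c, st')"
    using LoopS.IH(1)[of "l + 1"] LoopS.prems by (auto simp: code_at_append code_at_Cons)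
  obtain t2 where t2: "t2 \<le> t'" "(?f ^^ t2) (l, st') = (l + csize (Loop r a c), st'')"
    using LoopS.IH(2)[of l] LoopS.prems by auto
  have a: "?f (l, st) = (l + 1, st)"
    using LoopS.prems LoopS.hyps(1) by (cases st) (auto simp: code_at_append code_at_Cons)
  have b: "?f (l + 1 + csize c, st') = (l, st')"
    using LoopS.prems by (cases st') (auto simp: code_at_append code_at_Cons)
  have "(?f ^^ (Suc t1 + Suc t2)) (l, st) = (l + csize (Loop r a c), st'')"
    by (rule funpow_trans[OF funpow_one[of ?f, OF a t1(2)] funpow_one[of ?f, OF b t2(2)]])
  then show ?case using t1(1) t2(1) by (intro exI[of _ "Suc t1 + Suc t2"]) simp
next
  case (Weaken c st t st' t')
  then show ?case by (meson le_trans)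
qed

section \<open>Execution of jump code on a multi-tape machine\<close>

definition state_of :: "instr list \<Rightarrow> nat \<Rightarrow> nat" where
  "state_of P l = (if l < length P then l + 3 else 1)"

text \<open>State 0 marks the cell for 0 on the register tapes and moves the input head left; state
  2 then marks the cell before the input. Tape \<open>m\<close> is the output tape and stays
  unmarked. Instruction \<open>l\<close> is state \<open>l + 3\<close>, as 0, 1 and 2 are taken. A
  decrement that reads the mark does not move, which gives truncated subtraction.\<close>

definition compiled_trans ::
  "nat \<Rightarrow> instr list \<Rightarrow> nat \<Rightarrow> nat list \<Rightarrow> nat \<times> (nat \<times> move) list" where
  "compiled_trans m P q ss =
     (if q = 0 then
        (2, map (\<lambda>i. (if i = 0 \<or> i = m then ss ! i else 3, if i = 0 then Left else Stay)) [0..<m + 1])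
      else if q = 2 then
        (state_of P 0, map (\<lambda>i. (if i = 0 then 3 else ss ! i, Stay)) [0..<m + 1])
      else case P ! (q - 3) of
        IInc r \<Rightarrow> (state_of P (q - 2), map (\<lambda>i. (ss ! i, if i = r then Right else Stay)) [0..<m + 1])
      | IDec r \<Rightarrow> (state_of P (q - 2),
          map (\<lambda>i. (ss ! i, if i = r \<and> ss ! i \<noteq> 3 then Left else Stay)) [0..<m + 1])
      | IEmit b \<Rightarrow> (state_of P (q - 2),
          map (\<lambda>i. if i = m then (if b then 2 else 1, Right) else (ss ! i, Stay)) [0..<m + 1])
      | IBranch r a l l' \<Rightarrow> (state_of P (if ss ! r = a then l else l'),
          map (\<lambda>i. (ss ! i, Stay)) [0..<m + 1]))"

definition compiled_tm :: "nat \<Rightarrow> instr list \<Rightarrow> tm" where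
  "compiled_tm m P =
     \<lparr>num_tapes = m + 1, num_symbols = 4, num_states = length P + 3, trans = compiled_trans m P\<rparr>"

lemma wf_compiled_tm:
  shows "wf_tm (compiled_tm m P)"
proof -
  have *: "ss ! i < 4" if "length ss = Suc m" "set ss \<subseteq> {..<4}" "i < Suc m" for ss :: "nat list" and i
    using that by (metis lessThan_iff nth_mem subsetD)
  have st: "state_of P l < length P + 3" for l by (simp add: state_of_def)
  show ?thesis
    unfolding wf_tm_def compiled_tm_def
    by (auto simp: compiled_trans_def st simp del: upt_Suc split: instr.splits if_splits intro: *)
qed

definition config_of :: "nat \<Rightarrow> bool list \<Rightarrow> instr list \<Rightarrow> nat \<times> state \<Rightarrow> config" where
  "config_of m x P = (\<lambda>(l, s, w). (state_of P l,
     map (\<lambda>i. if i = m then (int (length w), word_tape w)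
              else if i = 0 then (int (s 0) - 1, (word_tape x)(-1 := 3))
              else (int (s i), (\<lambda>_. 0)(0 := 3))) [0..<m + 1]))"

lemma word_tape_append: "word_tape (w @ [b]) = (word_tape w)(int (length w) := if b then 2 else 1)"
  by (auto simp: word_tape_def fun_eq_iff nth_append)

lemma word_tape_Nil: "word_tape [] = (\<lambda>_. 0)"
  by (auto simp: word_tape_def)

lemma word_tape_le: "word_tape w i \<le> 2"
  by (simp add: word_tape_def)

lemma tm_step_config_of:
  assumes "l < length P" and "iregister (P ! l) < m"
  shows "tm_step (compiled_tm m P) (config_of m x P (l, s, w)) = config_of m x P (istep x P (l, s, w))"
proof -
  define T where "T = (\<lambda>i. if i = m then (int (length w), word_tape w)
              else if i = 0 then (int (s 0) - 1, (word_tape x)(-1 := 3))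
              else (int (s i), (\<lambda>_. 0)(0 := (3::nat))))"
  define upd where "upd = (\<lambda>(h :: int, c :: int \<Rightarrow> nat) (a, d). (h + displacement d, c(h := a)))"
  define ss where "ss = map (\<lambda>(h, c). c h) (map T [0..<m + 1])"
  have ss: "ss ! i = snd (T i) (fst (T i))" if "i < m + 1" for i
    using that by (simp add: ss_def case_prod_beta del: upt_Suc)
  have ssr: "ss ! r = head_symbol x r (s r)" if "r < m" for r
    using that ss[of r] by (auto simp: T_def head_symbol_def word_tape_def)
  have h3: "head_symbol x r v = 3 \<longleftrightarrow> v = 0" for r v
    using word_tape_le[of x "int v - 1"] by (auto simp: head_symbol_def)
  \<comment> \<open>Writing back the scanned symbol changes no contents. So apart from the output
    tape in the case \<open>IEmit\<close>, a step is nothing but head movement.\<close>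
  have keep: "upd (T i) (ss ! i, d) = (fst (T i) + displacement d, snd (T i))" if "i < m + 1" for i d
    using ss[OF that] by (simp add: upd_def case_prod_beta)
  have step: "tm_step (compiled_tm m P) (config_of m x P (l, s, w)) = (q, map (\<lambda>i. upd (T i) (g i)) [0..<m + 1])"
    if "compiled_trans m P (l + 3) ss = (q, map g [0..<m + 1])" for q g
    using that assms(1)
    by (simp add: tm_step_def config_of_def state_of_def compiled_tm_def ss_def upd_def T_def
      map2_map_map del: upt_Suc)
  show ?thesis
  proof (cases "P ! l")
    case (IInc r)
    have "compiled_trans m P (l + 3) ss =
        (state_of P (l + 1), map (\<lambda>i. (ss ! i, if i = r then Right else Stay)) [0..<m + 1])"
      by (simp add: compiled_trans_def IInc del: upt_Suc)
    from step[OF this] show ?thesis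
      using assms IInc by (auto simp: config_of_def keep simp del: upt_Suc) (auto simp: T_def)
  next
    case (IDec r)
    have "compiled_trans m P (l + 3) ss =
        (state_of P (l + 1), map (\<lambda>i. (ss ! i, if i = r \<and> ss ! i \<noteq> 3 then Left else Stay)) [0..<m + 1])"
      by (simp add: compiled_trans_def IDec del: upt_Suc)
    from step[OF this] show ?thesis
      using assms IDec by (auto simp: config_of_def keep simp del: upt_Suc) (auto simp: T_def ssr h3)
  next
    case (IEmit b)
    have "compiled_trans m P (l + 3) ss =
        (state_of P (l + 1), map (\<lambda>i. if i = m then (if b then 2 else 1, Right) else (ss ! i, Stay)) [0..<m + 1])"
      by (simp add: compiled_trans_def IEmit del: upt_Suc)
    from step[OF this] show ?thesis
      using assms IEmit by (auto simp: config_of_def keep simp del: upt_Suc)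
        (auto simp: T_def upd_def word_tape_append)
  next
    case (IBranch r a l1 l2)
    have "compiled_trans m P (l + 3) ss =
        (state_of P (if ss ! r = a then l1 else l2), map (\<lambda>i. (ss ! i, Stay)) [0..<m + 1])"
      by (simp add: compiled_trans_def IBranch del: upt_Suc)
    from step[OF this] show ?thesis
      using assms IBranch ssr by (auto simp: config_of_def keep simp del: upt_Suc) (auto simp: T_def)
  qed
qed

lemma tm_steps_config_of:
  assumes "\<And>i. i \<in> set P \<Longrightarrow> iregister i < m"
    and "(istep x P ^^ t) (0, s, w) = (length P, s', w')"
  shows "(tm_step (compiled_tm m P) ^^ t) (config_of m x P (0, s, w)) = config_of m x P (length P, s', w')"
proof -
  have "(tm_step (compiled_tm m P) ^^ t) (config_of m x P cf) = config_of m x P ((istep x P ^^ t) cf)" for cf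
  proof (induction t)
    case (Suc t)
    obtain l s w where *: "(istep x P ^^ t) cf = (l, s, w)" by (metis prod_cases3)
    have "tm_step (compiled_tm m P) (config_of m x P (l, s, w)) = config_of m x P (istep x P (l, s, w))"
    proof (cases "l < length P")
      case True
      then show ?thesis using tm_step_config_of assms(1) nth_mem by blast
    next
      case False
      then show ?thesis by (simp add: tm_step_def config_of_def state_of_def del: upt_Suc)
    qed
    then show ?case using Suc * by simp
  qed simp
  then show ?thesis using assms(2) by simp
qed

lemma funpow_fixed_le:
  assumes "(f ^^ t) a = b" "f b = b" "t \<le> t'"
  shows "(f ^^ t') a = b"
proof -
  have "(f ^^ n) b = b" for n by (induction n) (auto simp: assms(2))
  then show ?thesis using funpow_trans[of t f a b "t' - t" b] assms by simp
qed

lemma runs_tm_outputs_within: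
  assumes "runs x c (\<lambda>_. 0, []) t (s, w)" and "registers c \<subseteq> {..<m}" and "0 < m"
  shows "tm_outputs_within (compiled_tm m (compile 0 c)) [x] w (t + 2)"
proof -
  let ?P = "compile 0 c" let ?M = "compiled_tm m ?P"
  let ?end = "config_of m x ?P (length ?P, s, w)"
  have "code_at ?P 0 ?P" unfolding code_at_def by (intro exI[of _ "[]"]) auto
  from compile_correct[OF assms(1) this] obtain t' where t': "t' \<le> t"
    "(istep x ?P ^^ t') (0, \<lambda>_. 0, []) = (length ?P, s, w)" by auto
  have "iregister i < m" if "i \<in> set ?P" for i
    using iregister_compile[OF that] assms(2,3) by auto
  from tm_steps_config_of[OF this t'(2)]
  have a: "(tm_step ?M ^^ t') (config_of m x ?P (0, \<lambda>_. 0, [])) = ?end" by simp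
  \<comment> \<open>The two preparatory steps install the marks; they are the 2 in the time
    bound.\<close>
  have "tm_step ?M (tm_step ?M (tm_initial ?M [x])) = config_of m x ?P (0, \<lambda>_. 0, [])"
    using assms(3)
    by (auto simp: tm_step_def tm_initial_def compiled_tm_def compiled_trans_def config_of_def
      map2_map_map word_tape_Nil fun_eq_iff simp del: upt_Suc)
  then have "(tm_step ?M ^^ Suc (Suc t')) (tm_initial ?M [x]) = ?end"
    using funpow_one[OF refl funpow_one[OF _ a]] by blast
  moreover have "tm_step ?M ?end = ?end"
    by (simp add: tm_step_def config_of_def state_of_def del: upt_Suc)
  ultimately have "(tm_step ?M ^^ (t + 2)) (tm_initial ?M [x]) = ?end"
    using funpow_fixed_le t'(1) by (metis Suc_le_mono add_2_eq_Suc')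
  then show ?thesis
    by (simp add: tm_outputs_within_def config_of_def state_of_def)
qed

lemma finite_registers: "finite (registers c)"
  by (induction c) auto

lemma poly_time_program:
  assumes "\<And>x. \<exists>s. runs x c (\<lambda>_. 0, []) (poly p (length x)) (s, f x)"
  shows "poly_time 1 (\<lambda>ws. f (ws ! 0))"
proof -
  obtain m where m: "registers c \<subseteq> {..<m}" "0 < m"
    by (metis finite_nat_iff_bounded finite_registers finite_insert insert_subset lessThan_iff
        not_gr_zero not_less0)
  have "tm_outputs_within (compiled_tm m (compile 0 c)) ws (f (ws ! 0))
      (poly (p + [:2:]) (sum_list (map length ws)))" if "length ws = 1" for ws
  proof -
    from that obtain x where ws: "ws = [x]" by (auto simp: length_Suc_conv)
    show ?thesis
      using assms[of x] runs_tm_outputs_within[OF _ m, of x] by (auto simp: ws)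
  qed
  then show ?thesis
    unfolding poly_time_def using wf_compiled_tm[of m "compile 0 c"]
    by (intro exI[of _ "compiled_tm m (compile 0 c)"] exI[of _ "p + [:2:]"])
       (simp add: compiled_tm_def)
qed

section \<open>Polynomial-time emission of words\<close>

text \<open>Makes a test for the symbol 3 a zero test, so \<open>Loop r 3 c\<close> repeats
  \<open>c\<close> until register \<open>r\<close> is 0. This includes register 0, since input cells
  contain at most 2.\<close>

lemma head_symbol_eq_3 [simp]: "head_symbol x r v = 3 \<longleftrightarrow> v = 0"
  using word_tape_le[of x "int v - 1"] by (auto simp: head_symbol_def)

lemma runs_eq: "runs x c st t st' \<Longrightarrow> st' = st'' \<Longrightarrow> t \<le> t' \<Longrightarrow> runs x c st t' st''"
  using Weaken by blast

lemma runs_Loop: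
  assumes "\<And>k. k < K \<Longrightarrow> runs x c (S k) T (S (Suc k))"
    and "\<And>k. k < K \<Longrightarrow> head_symbol x r (fst (S k) r) \<noteq> a"
    and "head_symbol x r (fst (S K) r) = a"
  shows "runs x (Loop r a c) (S 0) (K * (T + 2) + 1) (S K)"
  using assms
proof (induction K arbitrary: S)
  case 0
  then show ?case using LoopE[of x r "S 0"] by simp
next
  case (Suc K)
  have "runs x (Loop r a c) (S (Suc 0)) (K * (T + 2) + 1) (S (Suc K))"
    using Suc.IH[of "\<lambda>k. S (Suc k)"] Suc.prems by simp
  then show ?case
    using LoopS[of x r "S 0" a c T "S (Suc 0)"] Suc.prems by (rule_tac runs_eq[OF LoopS]) auto
qed

lemma runs_Seq: "runs x c st t st' \<Longrightarrow> runs x c' st' t' st'' \<Longrightarrow> t + t' \<le> T \<Longrightarrow> runs x (c ;; c') st T st''"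
  using Seq Weaken by blast

lemma runs_Inc: "s' = s(r := Suc (s r)) \<Longrightarrow> runs x (Inc r) (s, w) (Suc 0) (s', w)"
  using Inc[of x r s w] by simp

lemma runs_Dec: "s' = s(r := s r - 1) \<Longrightarrow> runs x (Dec r) (s, w) (Suc 0) (s', w)"
  using Dec[of x r s w] by simp

section \<open>Arithmetic on counters\<close>

definition Clear :: "nat \<Rightarrow> cmd" where
  "Clear z = Loop z 3 (Dec z)"

lemma runs_Clear: "runs x (Clear z) (s, w) (3 * s z + 1) (s(z := 0), w)"
proof -
  let ?S = "\<lambda>k. (s(z := s z - k), w)"
  have "runs x (Clear z) (?S 0) (s z * (1 + 2) + 1) (?S (s z))"
    unfolding Clear_def by (rule runs_Loop) (auto intro!: runs_Dec)
  moreover have eqs: "?S 0 = (s, w)" "?S (s z) = (s(z := 0), w)" by auto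
  ultimately have "runs x (Clear z) (s, w) (s z * (1 + 2) + 1) (s(z := 0), w)" by metis
  then show ?thesis by (rule runs_eq) auto
qed

primrec Incs :: "nat \<Rightarrow> nat \<Rightarrow> cmd" where
  "Incs z 0 = Skip"
| "Incs z (Suc k) = Inc z ;; Incs z k"

lemma runs_Incs: "runs x (Incs z k) (s, w) k (s(z := s z + k), w)"
proof (induction k arbitrary: s)
  case 0
  then show ?case by (simp add: Skip)
next
  case (Suc k)
  show ?case unfolding Incs.simps by (rule runs_eq[OF Seq[OF Inc Suc.IH]]) auto
qed

primrec Decs :: "nat \<Rightarrow> nat \<Rightarrow> cmd" where
  "Decs z 0 = Skip"
| "Decs z (Suc k) = Dec z ;; Decs z k"

lemma runs_Decs: "runs x (Decs z k) (s, w) k (s(z := s z - k), w)"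
proof (induction k arbitrary: s)
  case 0
  then show ?case by (simp add: Skip)
next
  case (Suc k)
  show ?case unfolding Decs.simps by (rule runs_eq[OF Seq[OF Dec Suc.IH]]) auto
qed

text \<open>A counter is read by running it down. So the first loop copies \<open>y\<close> to the
  scratch register \<open>u\<close> while changing \<open>z\<close>, and the second restores
  \<open>y\<close>.\<close>

definition Add :: "nat \<Rightarrow> nat \<Rightarrow> nat \<Rightarrow> cmd" where
  "Add u z y = Loop y 3 (Dec y ;; Inc z ;; Inc u) ;; Loop u 3 (Dec u ;; Inc y)"

definition Sub :: "nat \<Rightarrow> nat \<Rightarrow> nat \<Rightarrow> cmd" where
  "Sub u z y = Loop y 3 (Dec y ;; Dec z ;; Inc u) ;; Loop u 3 (Dec u ;; Inc y)"

lemma runs_Add: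
  assumes "s u = 0" "u \<noteq> z" "u \<noteq> y" "z \<noteq> y"
  shows "runs x (Add u z y) (s, w) (9 * s y + 2) (s(z := s z + s y), w)"
proof -
  let ?S = "\<lambda>k. (s(y := s y - k, z := s z + k, u := k), w)"
  let ?R = "\<lambda>k. (s(z := s z + s y, u := s y - k, y := k), w)"
  have 1: "runs x (Loop y 3 (Dec y ;; Inc z ;; Inc u)) (?S 0) (s y * (3 + 2) + 1) (?S (s y))"
    by (rule runs_Loop)
      (use assms in \<open>auto intro!: runs_Seq[OF Dec] runs_Seq[OF Inc] runs_Inc simp: fun_eq_iff\<close>)
  have 2: "runs x (Loop u 3 (Dec u ;; Inc y)) (?R 0) (s y * (2 + 2) + 1) (?R (s y))"
    by (rule runs_Loop) (use assms in \<open>auto intro!: runs_Seq[OF Dec] runs_Inc simp: fun_eq_iff\<close>)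
  have "?S (s y) = ?R 0" "?S 0 = (s, w)" "?R (s y) = (s(z := s z + s y), w)"
    using assms by (auto simp: fun_eq_iff)
  then show ?thesis
    unfolding Add_def using runs_Seq[OF 1, of _ _ _ "9 * s y + 2"] 2 by simp
qed

lemma runs_Sub:
  assumes "s u = 0" "u \<noteq> z" "u \<noteq> y" "z \<noteq> y"
  shows "runs x (Sub u z y) (s, w) (9 * s y + 2) (s(z := s z - s y), w)"
proof -
  let ?S = "\<lambda>k. (s(y := s y - k, z := s z - k, u := k), w)"
  let ?R = "\<lambda>k. (s(z := s z - s y, u := s y - k, y := k), w)"
  have 1: "runs x (Loop y 3 (Dec y ;; Dec z ;; Inc u)) (?S 0) (s y * (3 + 2) + 1) (?S (s y))"
    by (rule runs_Loop)
      (use assms in \<open>auto intro!: runs_Seq[OF Dec] runs_Seq[OF Inc] runs_Inc simp: fun_eq_iff\<close>)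
  have 2: "runs x (Loop u 3 (Dec u ;; Inc y)) (?R 0) (s y * (2 + 2) + 1) (?R (s y))"
    by (rule runs_Loop) (use assms in \<open>auto intro!: runs_Seq[OF Dec] runs_Inc simp: fun_eq_iff\<close>)
  have "?S (s y) = ?R 0" "?S 0 = (s, w)" "?R (s y) = (s(z := s z - s y), w)"
    using assms by (auto simp: fun_eq_iff)
  then show ?thesis
    unfolding Sub_def using runs_Seq[OF 1, of _ _ _ "9 * s y + 2"] 2 by simp
qed

text \<open>Horner's scheme: with the value of \<open>p\<close> in \<open>z\<close>, the product
  with \<open>n\<close> is accumulated in \<open>v\<close> by one addition per decrement of
  \<open>z\<close>, moved back to \<open>z\<close>, and increased by the constant
  coefficient.\<close>

lemma ex_poly_cmd:
  fixes p :: "nat poly"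
  assumes "distinct [u, v, z, n]"
  shows "\<exists>c q. \<forall>x s w. s u = 0 \<longrightarrow> s v = 0 \<longrightarrow> s z = 0 \<longrightarrow>
    runs x c (s, w) (poly q (s n)) (s(z := poly p (s n)), w)"
proof (induction p rule: pCons_induct)
  case 0
  show ?case by (rule exI[of _ Skip], rule exI[of _ 0]) (auto intro: runs_eq[OF Skip] simp: fun_eq_iff)
next
  case (pCons a p)
  from pCons.IH obtain c q where c: "\<And>x s w. \<lbrakk>s u = 0; s v = 0; s z = 0\<rbrakk> \<Longrightarrow>
    runs x c (s, w) (poly q (s n)) (s(z := poly p (s n)), w)" by blast
  define c' where "c' = c ;; Loop z 3 (Dec z ;; Add u v n) ;; Loop v 3 (Dec v ;; Inc z) ;; Incs z a"
  \<comment> \<open>A round of the first loop costs \<open>9 * n + 3\<close> plus 2 for control,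
    each unit moved back costs 4, and \<open>a + 2\<close> pays for the increments and the two loop
    exits.\<close>
  define q' :: "nat poly" where "q' = q + p * [:5, 9:] + p * [:0, 4:] + [:a + 2:]"
  have "runs x c' (s, w) (poly q' (s n)) (s(z := poly (pCons a p) (s n)), w)"
    if s: "s u = 0" "s v = 0" "s z = 0" for x s w
  proof -
    let ?n = "s n" and ?m = "poly p (s n)"
    let ?S = "\<lambda>k. (s(z := ?m - k, v := k * ?n), w)"
    let ?R = "\<lambda>k. (s(v := ?m * ?n - k, z := k), w)"
    have "runs x (Dec z ;; Add u v n) (?S k) (9 * ?n + 3) (?S (Suc k))" if "k < ?m" for k
      by (rule runs_eq[OF runs_Seq[OF Dec runs_Add]])
        (use s assms in \<open>auto simp: fun_eq_iff\<close>)
    then have 1: "runs x (Loop z 3 (Dec z ;; Add u v n)) (?S 0) (?m * (9 * ?n + 3 + 2) + 1) (?S ?m)"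
      by (rule runs_Loop) (use assms in auto)
    have 2: "runs x (Loop v 3 (Dec v ;; Inc z)) (?R 0) (?m * ?n * (2 + 2) + 1) (?R (?m * ?n))"
      by (rule runs_Loop) (use assms in \<open>auto intro!: runs_Seq[OF Dec] runs_Inc simp: fun_eq_iff\<close>)
    have eqs: "?S 0 = (s(z := ?m), w)" "?S ?m = ?R 0"
      using s assms by (auto simp: fun_eq_iff)
    have 3: "runs x (Incs z a) (?R (?m * ?n)) a (s(z := poly (pCons a p) (s n)), w)"
      by (rule runs_eq[OF runs_Incs]) (use s assms in \<open>auto simp: fun_eq_iff algebra_simps\<close>)
    show ?thesis
      unfolding c'_def
      by (rule runs_eq[OF Seq[OF c[OF s] Seq[OF 1[unfolded eqs] Seq[OF 2 3]]]])
        (auto simp: q'_def algebra_simps)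
  qed
  then show ?case by blast
qed

text \<open>
  The state transformers below leave the registers as they found them and append a word to the
  output, in time polynomial in the largest register. \<open>Z\<close> is the set of scratch registers.
\<close>

definition emits :: "nat set \<Rightarrow> cmd \<Rightarrow> nat poly \<Rightarrow> (bool list \<Rightarrow> store \<Rightarrow> bool list) \<Rightarrow> bool" where
  "emits Z c p f \<longleftrightarrow> (\<forall>x M s w. (\<forall>r. s r \<le> M) \<longrightarrow> (\<forall>r \<in> Z. s r = 0) \<longrightarrow>
     runs x c (s, w) (poly p M) (s, w @ f x s))"

lemma emitsD:
  "emits Z c p f \<Longrightarrow> (\<And>r. s r \<le> M) \<Longrightarrow> (\<And>r. r \<in> Z \<Longrightarrow> s r = 0) \<Longrightarrow>
     runs x c (s, w) (poly p M) (s, w @ f x s)"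
  unfolding emits_def by blast

definition emittable :: "nat set \<Rightarrow> (bool list \<Rightarrow> store \<Rightarrow> bool list) \<Rightarrow> bool" where
  "emittable Z f \<longleftrightarrow> (\<exists>c p. emits Z c p f)"

lemma emittableI:
  assumes "\<And>x M s w. (\<And>r. s r \<le> M) \<Longrightarrow> (\<And>r. r \<in> Z \<Longrightarrow> s r = 0) \<Longrightarrow> runs x c (s, w) (poly p M) (s, w @ f x s)"
  shows "emittable Z f"
  unfolding emittable_def emits_def by (intro exI[of _ c] exI[of _ p]) (simp add: assms)

lemma emittable_Nil: "emittable Z (\<lambda>x s. [])"
  by (rule emittableI[of _ Skip 0]) (simp add: Skip)

lemma emittable_append:
  assumes "emittable Z f" "emittable Z g"
  shows "emittable Z (\<lambda>x s. f x s @ g x s)"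
proof -
  from assms(1) obtain c p where c: "emits Z c p f" unfolding emittable_def by blast
  from assms(2) obtain c' p' where c': "emits Z c' p' g" unfolding emittable_def by blast
  show ?thesis
    by (rule emittableI[of _ "c ;; c'" "p + p'"]) (use Seq[OF emitsD[OF c] emitsD[OF c']] in auto)
qed

lemma emittable_const: "emittable Z (\<lambda>x s. bs)"
proof (induction bs)
  case Nil
  show ?case by (rule emittable_Nil)
next
  case (Cons b bs)
  have "emittable Z (\<lambda>x s. [b])"
    by (rule emittableI[of _ "Emit b" 1]) (use Emit in auto)
  from emittable_append[OF this Cons] show ?case by simp
qed

lemma emittable_concat_map:
  "(\<And>k. k \<in> set ks \<Longrightarrow> emittable Z (f k)) \<Longrightarrow> emittable Z (\<lambda>x s. concat (map (\<lambda>k. f k x s) ks))"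
proof (induction ks)
  case Nil
  show ?case by (simp add: emittable_Nil)
next
  case (Cons k ks)
  then show ?case using emittable_append[of Z "f k"] by simp
qed

text \<open>The loop waits for zero, so \<open>j\<close> counts down from \<open>s b\<close> while
  \<open>i\<close> counts up. Both can be nonzero in the body and thus are not scratch registers of
  \<open>f\<close>; \<open>j\<close> is an artefact of the loop, so \<open>f\<close> must not depend
  on it.\<close>

lemma emittable_for:
  assumes f: "emittable Z f" and dep: "\<And>x s v. f x (s(j := v)) = f x s"
    and neq: "distinct [i, j, b, u]" "i \<notin> Z" "j \<notin> Z" and sub: "insert i (insert j (insert u Z)) \<subseteq> Z'"
  shows "emittable Z' (\<lambda>x s. concat (map (\<lambda>k. f x (s(i := k))) [0..<s b]))"
proof -
  from f obtain c p where c: "emits Z c p f" unfolding emittable_def by blast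
  define c' where "c' = Add u j b ;; Loop j 3 (c ;; Dec j ;; Inc i) ;; Clear i"
  define p' :: "nat poly" where "p' = [:4, 12:] + [:0, 1:] * (p + [:4:])"
  show ?thesis
  proof (rule emittableI[of _ c' p'])
    fix x M and s :: store and w
    assume M: "\<And>r. s r \<le> M" and Z: "\<And>r. r \<in> Z' \<Longrightarrow> s r = 0"
    have z: "s i = 0" "s j = 0" "s u = 0" using Z sub by auto
    let ?S = "\<lambda>k. (s(i := k, j := s b - k), w @ concat (map (\<lambda>k. f x (s(i := k))) [0..<k]))"
    have body: "runs x (c ;; Dec j ;; Inc i) (?S k) (poly p M + 2) (?S (Suc k))" if "k < s b" for k
    proof (rule runs_eq[OF Seq[OF emitsD[OF c] Seq[OF Dec Inc]]])
      show "(s(i := k, j := s b - k)) r \<le> M" for r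
        using M[of r] M[of b] that by auto
      show "(s(i := k, j := s b - k)) r = 0" if "r \<in> Z" for r
        using Z[of r] sub neq that by auto
    qed (use dep neq in \<open>auto simp: fun_eq_iff\<close>)
    have loop: "runs x (Loop j 3 (c ;; Dec j ;; Inc i)) (?S 0) (s b * (poly p M + 2 + 2) + 1) (?S (s b))"
      by (rule runs_Loop[where S = ?S, OF body]) (use neq in auto)
    have add: "runs x (Add u j b) (s, w) (9 * s b + 2) (?S 0)"
      by (rule runs_eq[OF runs_Add]) (use z neq in \<open>auto simp: fun_eq_iff\<close>)
    have clear: "runs x (Clear i) (?S (s b)) (3 * s b + 1) (s, snd (?S (s b)))"
      using z neq by (auto intro!: runs_eq[OF runs_Clear] simp: fun_eq_iff)
    have "9 * s b + 2 + (s b * (poly p M + 2 + 2) + 1 + (3 * s b + 1)) \<le> poly p' M"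
      using M[of b] mult_le_mono1[OF M[of b], of "poly p M + 16"] by (simp add: p'_def algebra_simps)
    with Seq[OF add Seq[OF loop clear]]
    show "runs x c' (s, w) (poly p' M) (s, w @ concat (map (\<lambda>k. f x (s(i := k))) [0..<s b]))"
      unfolding c'_def using Weaken by auto
  qed
qed

text \<open>A test has no result register; it is described by its ability to select between any two
  continuations. Connectives then are nested conditionals. The duplicated continuations enlarge the
  program, but not in dependence on the input.\<close>

definition testable :: "nat set \<Rightarrow> (bool list \<Rightarrow> store \<Rightarrow> bool) \<Rightarrow> bool" where
  "testable Z P \<longleftrightarrow> (\<forall>f g. emittable Z f \<longrightarrow> emittable Z g \<longrightarrow>
     emittable Z (\<lambda>x s. if P x s then f x s else g x s))"

lemma testable_const: "testable Z (\<lambda>x s. b)"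
  unfolding testable_def by (cases b) auto

lemma testable_not:
  assumes "testable Z P"
  shows "testable Z (\<lambda>x s. \<not> P x s)"
  unfolding testable_def
proof (intro allI impI)
  fix f g assume "emittable Z f" "emittable Z g"
  then have "emittable Z (\<lambda>x s. if P x s then g x s else f x s)"
    using assms unfolding testable_def by blast
  moreover have "(\<lambda>x s. if P x s then g x s else f x s) = (\<lambda>x s. if \<not> P x s then f x s else g x s)"
    by (auto simp: fun_eq_iff)
  ultimately show "emittable Z (\<lambda>x s. if \<not> P x s then f x s else g x s)" by simp
qed

lemma testable_and:
  assumes "testable Z P" "testable Z Q"
  shows "testable Z (\<lambda>x s. P x s \<and> Q x s)"
  unfolding testable_def
proof (intro allI impI)
  fix f g assume fg: "emittable Z f" "emittable Z g"
  then have "emittable Z (\<lambda>x s. if Q x s then f x s else g x s)"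
    using assms unfolding testable_def by blast
  then have "emittable Z (\<lambda>x s. if P x s then (if Q x s then f x s else g x s) else g x s)"
    using assms fg unfolding testable_def by blast
  moreover have "(\<lambda>x s. if P x s then (if Q x s then f x s else g x s) else g x s) =
      (\<lambda>x s. if P x s \<and> Q x s then f x s else g x s)"
    by (auto simp: fun_eq_iff)
  ultimately show "emittable Z (\<lambda>x s. if P x s \<and> Q x s then f x s else g x s)" by simp
qed

lemma testable_or:
  assumes "testable Z P" "testable Z Q"
  shows "testable Z (\<lambda>x s. P x s \<or> Q x s)"
  using testable_not[OF testable_and[OF testable_not[OF assms(1)] testable_not[OF assms(2)]]] by simp

text \<open>Comparisons and input lookup both come from this test. As subtraction truncates, the
  symbol 3 means \<open>s a + i \<le> s b + j\<close>; with \<open>z = 0\<close> the difference is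
  an address in the input. Both branches clear \<open>z\<close>, so the continuation finds the
  original store.\<close>

lemma testable_head_symbol:
  assumes Z: "z \<in> Z" "u \<in> Z" and neq: "distinct [u, z, a]" "distinct [u, z, b]"
  shows "testable Z (\<lambda>x s. head_symbol x z ((s a + i) - (s b + j)) = y)"
  unfolding testable_def
proof (intro allI impI)
  fix f g assume f: "emittable Z f" and g: "emittable Z g"
  from f obtain c p where c: "emits Z c p f" unfolding emittable_def by blast
  from g obtain d q where d: "emits Z d q g" unfolding emittable_def by blast
  define c' where "c' = Add u z a ;; Incs z i ;; Sub u z b ;; Decs z j ;; Branch z y (Clear z ;; c) (Clear z ;; d)"
  define p' :: "nat poly" where "p' = [:i * 4 + j + 7, 21:] + p + q"
  show "emittable Z (\<lambda>x s. if head_symbol x z ((s a + i) - (s b + j)) = y then f x s else g x s)"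
  proof (rule emittableI[of _ c' p'])
    fix x M and s :: store and w
    assume M: "\<And>r. s r \<le> M" and Z0: "\<And>r. r \<in> Z \<Longrightarrow> s r = 0"
    have z: "s z = 0" "s u = 0" using Z Z0 by auto
    let ?v = "(s a + i) - (s b + j)"
    have 1: "runs x (Add u z a) (s, w) (9 * s a + 2) (s(z := s a), w)"
      by (rule runs_eq[OF runs_Add]) (use z neq in auto)
    have 2: "runs x (Incs z i) (s(z := s a), w) i (s(z := s a + i), w)"
      by (rule runs_eq[OF runs_Incs]) auto
    have 3: "runs x (Sub u z b) (s(z := s a + i), w) (9 * s b + 2) (s(z := s a + i - s b), w)"
      by (rule runs_eq[OF runs_Sub]) (use z neq in auto)
    have 4: "runs x (Decs z j) (s(z := s a + i - s b), w) j (s(z := ?v), w)"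
      by (rule runs_eq[OF runs_Decs]) auto
    have 5: "runs x (Clear z) (s(z := ?v), w) (3 * ?v + 1) (s, w)"
      by (rule runs_eq[OF runs_Clear]) (use z in \<open>auto simp: fun_eq_iff\<close>)
    have 6: "runs x (Branch z y (Clear z ;; c) (Clear z ;; d)) (s(z := ?v), w)
        (3 * ?v + 1 + poly p M + poly q M + 2) (s, w @ (if head_symbol x z ?v = y then f x s else g x s))"
    proof (cases "head_symbol x z ?v = y")
      case True
      then show ?thesis
        by (auto intro!: runs_eq[OF BranchT[OF _ Seq[OF 5 emitsD[OF c, of s M]]]] simp: M Z0)
    next
      case False
      then show ?thesis
        by (auto intro!: runs_eq[OF BranchF[OF _ Seq[OF 5 emitsD[OF d, of s M]]]] simp: M Z0)
    qed
    show "runs x c' (s, w) (poly p' M) (s, w @ (if head_symbol x z ?v = y then f x s else g x s))"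
      unfolding c'_def
      by (rule runs_eq[OF Seq[OF 1 Seq[OF 2 Seq[OF 3 Seq[OF 4 6]]]]])
        (use M[of a] M[of b] in \<open>auto simp: p'_def\<close>)
  qed
qed

lemma testable_zero: "testable Z (\<lambda>x s. s a = 0)"
  unfolding testable_def
proof (intro allI impI)
  fix f g assume "emittable Z f" "emittable Z g"
  then obtain c p d q where c: "emits Z c p f" and d: "emits Z d q g"
    unfolding emittable_def by blast
  show "emittable Z (\<lambda>x s. if s a = 0 then f x s else g x s)"
  proof (rule emittableI[of _ "Branch a 3 c d" "p + q + [:2:]"])
    fix x M and s :: store and w
    assume M: "\<And>r. s r \<le> M" and Z0: "\<And>r. r \<in> Z \<Longrightarrow> s r = 0"
    show "runs x (Branch a 3 c d) (s, w) (poly (p + q + [:2:]) M) (s, w @ (if s a = 0 then f x s else g x s))"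
    proof (cases "s a = 0")
      case True
      then show ?thesis
        by (auto intro!: runs_eq[OF BranchT[OF _ emitsD[OF c, of s M]]] simp: M Z0)
    next
      case False
      then show ?thesis
        by (auto intro!: runs_eq[OF BranchF[OF _ emitsD[OF d, of s M]]] simp: M Z0)
    qed
  qed
qed

lemma testable_le:
  assumes "z \<in> Z" "u \<in> Z" "distinct [u, z, a]" "distinct [u, z, b]"
  shows "testable Z (\<lambda>x s. s a + i \<le> s b + j)"
  using testable_head_symbol[OF assms, of i j 3] by simp

lemma testable_eq:
  assumes "z \<in> Z" "u \<in> Z" "distinct [u, z, a]" "distinct [u, z, b]"
  shows "testable Z (\<lambda>x s. s a + i = s b + j)"
  using testable_and[OF testable_le[OF assms(1-4), of i j] testable_le[OF assms(1,2,4,3), of j i]]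
  by (simp add: eq_iff)

lemma emittable_bit:
  assumes "testable Z P"
  shows "emittable Z (\<lambda>x s. [P x s])"
proof -
  have "emittable Z (\<lambda>x s. if P x s then [True] else [False])"
    using assms emittable_const unfolding testable_def by blast
  moreover have "(\<lambda>x s. if P x s then [True] else [False]) = (\<lambda>x s. [P x s])" by (auto simp: fun_eq_iff)
  ultimately show ?thesis by simp
qed

text \<open>The first increment leaves the mark. All bits are nonblank, so the loop stops one cell
  past the last bit.\<close>

definition Length :: "nat \<Rightarrow> cmd" where
  "Length n = Inc 0 ;; Loop 0 0 (Inc 0 ;; Inc n) ;; Clear 0"

lemma runs_Length:
  assumes "s 0 = 0" "s n = 0" "n \<noteq> 0"
  shows "runs x (Length n) (s, w) (7 * length x + 6) (s(n := length x), w)"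
proof -
  let ?S = "\<lambda>k. (s(n := k, 0 := Suc k), w)"
  have 1: "runs x (Inc 0) (s, w) 1 (?S 0)"
    by (rule runs_eq[OF Inc]) (use assms in \<open>auto simp: fun_eq_iff\<close>)
  have 2: "runs x (Loop 0 0 (Inc 0 ;; Inc n)) (?S 0) (length x * (2 + 2) + 1) (?S (length x))"
    by (rule runs_Loop)
      (use assms in \<open>auto intro!: runs_Seq[OF Inc] runs_Inc simp: fun_eq_iff head_symbol_def word_tape_def\<close>)
  have 3: "runs x (Clear 0) (?S (length x)) (3 * (length x + 1) + 1) (s(n := length x), w)"
    by (rule runs_eq[OF runs_Clear]) (use assms in \<open>auto simp: fun_eq_iff\<close>)
  show ?thesis
    unfolding Length_def by (rule runs_eq[OF Seq[OF 1 Seq[OF 2 3]]]) auto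
qed

text \<open>Register 3 holds the input length.\<close>

definition set_polys :: "(nat \<times> nat poly) list \<Rightarrow> nat \<Rightarrow> store" where
  "set_polys rps n = foldr (\<lambda>(r, p) s. s(r := poly p n)) rps ((\<lambda>_. 0)(3 := n))"

lemma set_polys_Nil: "set_polys [] n = (\<lambda>_. 0)(3 := n)"
  by (simp add: set_polys_def)

lemma set_polys_Cons: "set_polys ((r, p) # rps) n = (set_polys rps n)(r := poly p n)"
  by (simp add: set_polys_def)

lemma set_polys_outside: "r \<notin> fst ` set rps \<Longrightarrow> r \<noteq> 3 \<Longrightarrow> set_polys rps n r = 0"
  by (induction rps) (auto simp: set_polys_Cons set_polys_Nil)

lemma ex_set_polys:
  assumes "distinct (map fst rps)" and "fst ` set rps \<inter> {0, 1, 2, 3} = {}"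
  shows "\<exists>c q. \<forall>x. runs x c (\<lambda>_. 0, []) (poly q (length x)) (set_polys rps (length x), [])"
  using assms
proof (induction rps)
  case Nil
  show ?case
    by (rule exI[of _ "Length 3"], rule exI[of _ "[:6, 7:]"])
      (auto simp: set_polys_Nil intro!: runs_eq[OF runs_Length])
next
  case (Cons rp rps)
  obtain r p where rp: "rp = (r, p)" by (cases rp)
  from Cons obtain c q where c: "\<And>x. runs x c (\<lambda>_. 0, []) (poly q (length x)) (set_polys rps (length x), [])"
    by auto
  have "distinct [1, 2, r, 3 :: nat]" using Cons.prems by (auto simp: rp)
  from ex_poly_cmd[OF this, of p] obtain d q' where d: "\<And>x s w. \<lbrakk>s 1 = 0; s 2 = 0; s r = 0\<rbrakk> \<Longrightarrow>
    runs x d (s, w) (poly q' (s 3)) (s(r := poly p (s 3)), w)" by blast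
  have z: "set_polys rps n 1 = 0" "set_polys rps n 2 = 0" "set_polys rps n r = 0" for n
    using Cons.prems by (auto simp: rp intro!: set_polys_outside)
  have n3: "set_polys rps n 3 = n" for n
    using Cons.prems(2) by (induction rps) (auto simp: set_polys_Cons set_polys_Nil)
  have "runs x (c ;; d) (\<lambda>_. 0, []) (poly (q + q') (length x)) (set_polys (rp # rps) (length x), [])" for x
    by (rule runs_eq[OF Seq[OF c d[OF z]]]) (auto simp: n3 rp set_polys_Cons)
  then show ?case by blast
qed

lemma poly_time_emittable:
  assumes "emittable Z f" and "distinct (map fst rps)" and "fst ` set rps \<inter> {0, 1, 2, 3} = {}"
    and "Z \<inter> insert 3 (fst ` set rps) = {}"
  shows "poly_time 1 (\<lambda>ws. f (ws ! 0) (set_polys rps (length (ws ! 0))))"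
proof -
  from assms(1) obtain c p where c: "emits Z c p f" unfolding emittable_def by blast
  from ex_set_polys[OF assms(2,3)] obtain d q where
    d: "\<And>x. runs x d (\<lambda>_. 0, []) (poly q (length x)) (set_polys rps (length x), [])" by blast
  \<comment> \<open>A common bound for all registers: emission is polynomial in the largest one, and
    composition with \<open>m\<close> makes it polynomial in the input length.\<close>
  define m :: "nat poly" where "m = [:0, 1:] + sum_list (map snd rps)"
  have m: "set_polys rps n r \<le> poly m n" for n r
  proof -
    have "set_polys rps n r \<le> n + poly (sum_list (map snd rps)) n"
      by (induction rps) (auto simp: set_polys_Cons set_polys_Nil)
    then show ?thesis by (simp add: m_def)
  qed
  have "runs x (d ;; c) (\<lambda>_. 0, []) (poly (q + pcompose p m) (length x))
      (set_polys rps (length x), f x (set_polys rps (length x)))" for x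
    by (rule runs_eq[OF Seq[OF d emitsD[OF c m]]])
      (use assms(4) in \<open>auto simp: poly_pcompose intro!: set_polys_outside\<close>)
  then have "poly_time 1 (\<lambda>ws. (\<lambda>x. f x (set_polys rps (length x))) (ws ! 0))"
    by (intro poly_time_program) blast
  then show ?thesis by simp
qed

section \<open>Selections and central paths in layered digraphs\<close>

lemma set_vwalk_arcs: "set (vwalk_arcs p) = {(p ! i, p ! Suc i) | i. Suc i < length p}"
proof (induction p rule: vwalk_arcs.induct)
  case (3 x y xs)
  have "{((x # y # xs) ! i, (x # y # xs) ! Suc i) | i. Suc i < length (x # y # xs)} =
      insert (x, y) {((y # xs) ! i, (y # xs) ! Suc i) | i. Suc i < length (y # xs)}" (is "?A = ?B")
  proof
    show "?A \<subseteq> ?B"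
    proof
      fix e assume "e \<in> ?A"
      then obtain i where i: "e = ((x # y # xs) ! i, (x # y # xs) ! Suc i)" "Suc i < length (x # y # xs)" by blast
      then show "e \<in> ?B" by (cases i) auto
    qed
    show "?B \<subseteq> ?A" by force
  qed
  then show ?case using 3 by simp
qed auto

lemma vwalk_with_proj_iff:
  "vwalk p (with_proj G) \<longleftrightarrow> p \<noteq> [] \<and> set p \<subseteq> pverts G \<and> (\<forall>i. Suc i < length p \<longrightarrow> (p ! i, p ! Suc i) \<in> parcs G)"
  unfolding vwalk_def set_vwalk_arcs with_proj_simps by blast

lemma vdist_le_1_iff:
  assumes "pair_digraph G" "u \<in> pverts G"
  shows "vdist G u v \<le> 1 \<longleftrightarrow> u = v \<or> (u, v) \<in> parcs G"
proof
  let ?S = "{p. vpath p (with_proj G) \<and> hd p = u \<and> last p = v}"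
  interpret pair_digraph G by fact
  {
    assume "vdist G u v \<le> 1"
    \<comment> \<open>The strict bound is what \<open>INF_less_iff\<close> needs to produce a
      path.\<close>
    then have "(INF p \<in> ?S. enat (vwalk_length p)) < 2"
      unfolding vdist_def by (rule le_less_trans) simp
    then obtain p where p: "vpath p (with_proj G)" "hd p = u" "last p = v" "enat (vwalk_length p) < 2"
      unfolding INF_less_iff by blast
    from p(4) have len: "length p \<le> 2" by (cases "length p") (auto simp: numeral_eq_enat)
    from p(1) have "p \<noteq> []" by (auto simp: vpath_def vwalk_def)
    then obtain a q where q: "p = a # q" by (cases p) auto
    show "u = v \<or> (u, v) \<in> parcs G"
    proof (cases q)
      case Nil
      then show ?thesis using p q by simp
    next
      case (Cons b r)
      then have "r = []" using len q by simp
      then show ?thesis using p(1-3) q Cons by (auto simp: vpath_def vwalk_def)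
    qed
  }
  {
    assume "u = v \<or> (u, v) \<in> parcs G"
    then have "\<exists>p \<in> ?S. vwalk_length p \<le> 1"
    proof
      assume "u = v"
      then show ?thesis using assms(2) by (intro bexI[of _ "[u]"]) (auto simp: vpath_def vwalk_def)
    next
      assume uv: "(u, v) \<in> parcs G"
      then have "u \<noteq> v" using pair_no_loops by fastforce
      then show ?thesis using uv
        by (intro bexI[of _ "[u, v]"]) (auto simp: vpath_def vwalk_def dest: in_arcsD1 in_arcsD2)
    qed
    then obtain p where p: "p \<in> ?S" "vwalk_length p \<le> 1" by blast
    from p(1) have "vdist G u v \<le> enat (vwalk_length p)" unfolding vdist_def by (rule INF_lower)
    also have "\<dots> \<le> 1" using p(2) by (simp add: one_enat_def)
    finally show "vdist G u v \<le> 1" .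
  }
qed

lemma max_closeness_le_1_iff:
  assumes "pair_digraph G" "pverts G \<noteq> {}" "P \<noteq> []"
  shows "max_closeness G P \<le> 1 \<longleftrightarrow> (\<forall>u \<in> pverts G. \<exists>v \<in> set P. u = v \<or> (u, v) \<in> parcs G)"
proof -
  interpret pair_digraph G by fact
  have "max_closeness G P \<le> 1 \<longleftrightarrow> (\<forall>u \<in> pverts G. path_dist G u P \<le> 1)"
    unfolding max_closeness_def using assms(2) pair_finite_verts by (subst Max_le_iff) auto
  also have "\<dots> \<longleftrightarrow> (\<forall>u \<in> pverts G. \<exists>v \<in> set P. vdist G u v \<le> 1)"
    unfolding path_dist_def using assms(3) by (subst Min_le_iff) auto
  also have "\<dots> \<longleftrightarrow> (\<forall>u \<in> pverts G. \<exists>v \<in> set P. u = v \<or> (u, v) \<in> parcs G)"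
    using vdist_le_1_iff[OF assms(1)] by (intro ball_cong bex_cong) auto
  finally show ?thesis .
qed

text \<open>
  Choosing one element of \<open>X\<close> per layer is choosing a path through the layers to the sink. An
  unchosen element of \<open>X\<close> is adjacent to the choice in the next layer, whereas a constraint
  vertex \<open>c \<in> C\<close> has distance at most 1 to the path only if the choice hits \<open>lits c\<close>.
\<close>

locale layered_digraph =
  fixes G :: "'a pair_pre_digraph" and X C :: "'a set" and sink first :: 'a
    and layer :: "'a \<Rightarrow> nat" and L :: nat and lits :: "'a \<Rightarrow> 'a set"
  assumes verts: "pverts G = insert sink (X \<union> C)"
    and fin: "finite X" "finite C"
    and disj: "sink \<notin> X" "sink \<notin> C" "X \<inter> C = {}"
    and arcs: "parcs G = {(u, v). u \<in> X \<and> v \<in> X \<and> layer v = Suc (layer u)} \<union>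
      {(u, v). u \<in> X \<and> Suc (layer u) = L \<and> v = sink} \<union> {(c, v). c \<in> C \<and> v \<in> lits c}"
    and lits: "\<And>c. c \<in> C \<Longrightarrow> lits c \<subseteq> X" "\<And>c. c \<in> C \<Longrightarrow> lits c \<noteq> {}"
    and layer: "\<And>u. u \<in> X \<Longrightarrow> layer u < L" "\<And>i. i < L \<Longrightarrow> \<exists>u \<in> X. layer u = i"
    and first: "first \<in> C" "\<And>u. u \<in> lits first \<Longrightarrow> layer u = 0"
begin

lemma pair_digraph: "pair_digraph G"
proof
  show "finite (pverts G)" using verts fin by simp
  show wf: "fst e \<in> pverts G" "snd e \<in> pverts G" if "e \<in> parcs G" for e
    using that lits(1)[THEN subsetD] by (auto simp: arcs verts)
  have "parcs G \<subseteq> pverts G \<times> pverts G" using wf by (auto simp: mem_Times_iff)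
  then show "finite (parcs G)" using \<open>finite (pverts G)\<close> finite_subset by blast
  show "fst e \<noteq> snd e" if "e \<in> parcs G" for e
    using that disj lits(1) by (fastforce simp: arcs)
qed

text \<open>Every vertex has an undirected route to the sink: an element of \<open>X\<close> climbs
  through the layers, none of which is empty, and a constraint steps to one of its literals.\<close>

lemma connected: "Digraph_Component.connected (with_proj G)"
proof -
  let ?R = "rtrancl_on (pverts G) ((parcs G)\<^sup>s)"
  interpret pair_digraph G by (rule pair_digraph)
  have arc: "(u, v) \<in> ?R" "(v, u) \<in> ?R" if "(u, v) \<in> parcs G" for u v
  proof -
    have "u \<in> pverts G" "v \<in> pverts G" using in_arcsD1[OF that] in_arcsD2[OF that] .
    moreover have "(u, v) \<in> (parcs G)\<^sup>s" "(v, u) \<in> (parcs G)\<^sup>s" using that by (auto simp: symcl_def)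
    ultimately show "(u, v) \<in> ?R" "(v, u) \<in> ?R"
      by (meson rtrancl_on.rtrancl_on_into_rtrancl_on rtrancl_on.rtrancl_on_refl)+
  qed
  have X: "(u, sink) \<in> ?R \<and> (sink, u) \<in> ?R" if "u \<in> X" for u
    using that
  proof (induction "L - layer u" arbitrary: u)
    case 0
    then show ?case using layer(1) by fastforce
  next
    case (Suc k)
    show ?case
    proof (cases "Suc (layer u) = L")
      case True
      then show ?thesis using arc[of u sink] Suc.prems by (auto simp: arcs)
    next
      case False
      then have "Suc (layer u) < L" using layer(1) Suc.prems by (simp add: Suc_lessI)
      then obtain v where v: "v \<in> X" "layer v = Suc (layer u)" using layer(2) by blast
      then have "(u, v) \<in> parcs G" using Suc.prems by (auto simp: arcs)
      moreover have "(v, sink) \<in> ?R \<and> (sink, v) \<in> ?R" using Suc.hyps v by auto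
      ultimately show ?thesis using arc rtrancl_on_trans by metis
    qed
  qed
  have all: "(u, sink) \<in> ?R \<and> (sink, u) \<in> ?R" if "u \<in> pverts G" for u
  proof -
    consider "u = sink" | "u \<in> X" | "u \<in> C" using \<open>u \<in> pverts G\<close> by (auto simp: verts)
    then show ?thesis
    proof cases
      case 1
      then show ?thesis using that by (auto intro: rtrancl_on.rtrancl_on_refl)
    next
      case 3
      then obtain v where v: "v \<in> lits u" using lits(2) by blast
      then have "(u, v) \<in> parcs G" "v \<in> X" using 3 lits(1) by (auto simp: arcs)
      then show ?thesis using arc X rtrancl_on_trans by metis
    qed (use X in auto)
  qed
  show ?thesis
    unfolding connected_conv with_proj_simps
  proof (intro conjI ballI)
    show "pverts G \<noteq> {}" by (simp add: verts)
    show "(u, v) \<in> ?R" if "u \<in> pverts G" "v \<in> pverts G" for u v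
      using all[OF that(1)] all[OF that(2)] by (meson rtrancl_on_trans)
  qed
qed

text \<open>A walk starting in layer 0 rises one layer per arc and enters the sink only from the
  last layer. So every walk from \<open>A 0\<close> to the sink has at least \<open>L\<close> arcs,
  and the one through the choices is shortest.\<close>

lemma selection_imp_path:
  assumes A: "\<And>i. i < L \<Longrightarrow> A i \<in> X \<and> layer (A i) = i"
    and hit: "\<And>c. c \<in> C \<Longrightarrow> \<exists>i < L. A i \<in> lits c"
  shows "\<exists>P \<in> shortest_paths G. max_closeness G P \<le> 1"
proof -
  define P where "P = map A [0..<L] @ [sink]"
  have len: "length P = Suc L" by (simp add: P_def)
  have "0 < L" using hit first(1) by fastforce
  have P_nth: "P ! i = (if i < L then A i else sink)" if "i \<le> L" for i
    using that by (auto simp: P_def nth_append)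
  have hd: "hd P = A 0" and last: "last P = sink"
    using \<open>0 < L\<close> by (simp_all add: P_def hd_append hd_map)
  have "inj_on A {0..<L}" using A by (metis atLeastLessThan_iff inj_onI)
  then have "distinct P"
    using A disj(1) by (auto simp: P_def distinct_map)
  moreover have "vwalk P (with_proj G)"
    unfolding vwalk_with_proj_iff
  proof (intro conjI allI impI)
    show "P \<noteq> []" by (simp add: P_def)
    show "set P \<subseteq> pverts G" using A by (auto simp: P_def verts)
    show "(P ! i, P ! Suc i) \<in> parcs G" if "Suc i < length P" for i
      using that A[of i] A[of "Suc i"] by (auto simp: len P_nth arcs)
  qed
  ultimately have vpath: "vpath P (with_proj G)" by (simp add: vpath_def)
  have "vdist G (A 0) sink = enat L"
    unfolding vdist_def
  proof (rule antisym)
    let ?S = "{p. vpath p (with_proj G) \<and> hd p = A 0 \<and> last p = sink}"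
    show "(INF p \<in> ?S. enat (vwalk_length p)) \<le> enat L"
      by (rule INF_lower2[of P]) (use vpath hd last len in auto)
    show "enat L \<le> (INF p \<in> ?S. enat (vwalk_length p))"
    proof (rule INF_greatest)
      fix p assume "p \<in> ?S"
      then have p: "p \<noteq> []" "hd p = A 0" "last p = sink"
        "\<And>i. Suc i < length p \<Longrightarrow> (p ! i, p ! Suc i) \<in> parcs G"
        by (auto simp: vpath_def vwalk_with_proj_iff)
      \<comment> \<open>No arc enters a constraint and none leaves the sink, so these are the only
        two possibilities.\<close>
      have "p ! i = sink \<and> L \<le> i \<or> p ! i \<in> X \<and> layer (p ! i) = i" if "i < length p" for i
        using that
      proof (induction i)
        case 0
        then show ?case using p A[OF \<open>0 < L\<close>] by (simp add: hd_conv_nth)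
      next
        case (Suc i)
        then show ?case using p(4)[of i] disj by (auto simp: arcs)
      qed
      from this[of "length p - 1"] have "L \<le> length p - 1"
        using p disj(1) by (auto simp: last_conv_nth)
      then show "enat L \<le> enat (vwalk_length p)" by simp
    qed
  qed
  then have "P \<in> shortest_paths G"
    using vpath by (simp add: shortest_paths_def hd last len)
  moreover have "max_closeness G P \<le> 1"
  proof (subst max_closeness_le_1_iff[OF pair_digraph])
    show "\<forall>u \<in> pverts G. \<exists>v \<in> set P. u = v \<or> (u, v) \<in> parcs G"
    proof
      fix u assume "u \<in> pverts G"
      then consider "u = sink" | "u \<in> X" | "u \<in> C" by (auto simp: verts)
      then show "\<exists>v \<in> set P. u = v \<or> (u, v) \<in> parcs G"
      proof cases
        case 1
        then show ?thesis by (simp add: P_def)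
      next
        case 2
        show ?thesis
        proof (cases "Suc (layer u) = L")
          case True
          then show ?thesis using 2 by (auto simp: arcs P_def)
        next
          case False
          then have "Suc (layer u) < L" using layer(1)[OF 2] by simp
          then show ?thesis using 2 A[of "Suc (layer u)"]
            by (intro bexI[of _ "A (Suc (layer u))"]) (auto simp: arcs P_def)
        qed
      next
        case 3
        then show ?thesis using hit[OF 3] by (auto simp: arcs P_def)
      qed
    qed
  qed (auto simp: verts P_def)
  ultimately show ?thesis by blast
qed

text \<open>The sink has no outgoing arcs, so it must lie on the path, as its last vertex. Closeness
  to \<open>first\<close> puts a vertex of layer 0 on the path; from there the path can only climb
  to the sink. It may start with a constraint vertex, whence the shift \<open>j\<close> in the
  indices.\<close>

lemma path_imp_selection:
  assumes "P \<in> shortest_paths G" and "max_closeness G P \<le> 1"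
  obtains A where "\<And>i. i < L \<Longrightarrow> A i \<in> X \<and> layer (A i) = i"
    and "\<And>c. c \<in> C \<Longrightarrow> \<exists>i < L. A i \<in> lits c"
proof -
  from assms(1) have P: "P \<noteq> []" "set P \<subseteq> pverts G" and
    arc: "\<And>i. Suc i < length P \<Longrightarrow> (P ! i, P ! Suc i) \<in> parcs G"
    by (auto simp: shortest_paths_def vpath_def vwalk_with_proj_iff)
  from assms(2) have dom: "\<exists>v \<in> set P. u = v \<or> (u, v) \<in> parcs G" if "u \<in> pverts G" for u
    using that by (subst (asm) max_closeness_le_1_iff[OF pair_digraph]) (auto simp: P verts)
  have sink_out: "(sink, v) \<notin> parcs G" for v using disj by (auto simp: arcs)
  have "sink \<in> set P" using dom[of sink] sink_out by (auto simp: verts)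
  then obtain e where e: "e < length P" "P ! e = sink" by (auto simp: in_set_conv_nth)
  have "Suc e = length P" using arc[of e] sink_out e by (metis Suc_lessI)
  then have last: "Suc i < length P" if "i < length P" "P ! i \<noteq> sink" for i
    using that e by (metis Suc_inject Suc_lessI)
  have up: "P ! (k + i) \<in> X \<and> layer (P ! (k + i)) = layer (P ! k) + i \<or> P ! (k + i) = sink"
    if "P ! k \<in> X" "k + i < length P" for k i
    using that(2)
  proof (induction i)
    case (Suc i)
    then show ?case using arc[of "k + i"] disj by (auto simp: arcs)
  qed (use that(1) in simp)
  \<comment> \<open>A constraint that itself lies on the path is not its last vertex, and its
    successor there is one of its literals.\<close>
  have hit: "\<exists>k < length P. P ! k \<in> lits c" if c: "c \<in> C" for c
  proof -
    obtain v where v: "v \<in> set P" "c = v \<or> (c, v) \<in> parcs G" using dom[of c] c verts by auto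
    then obtain k where k: "k < length P" "P ! k = v" by (auto simp: in_set_conv_nth)
    from v(2) show ?thesis
    proof
      assume "c = v"
      then have "Suc k < length P" using last k c disj(2) by auto
      then show ?thesis using arc[of k] k \<open>c = v\<close> c disj by (auto simp: arcs)
    next
      assume "(c, v) \<in> parcs G"
      then show ?thesis using k c disj by (auto simp: arcs)
    qed
  qed
  obtain j where j: "j < length P" "P ! j \<in> lits first" using hit first(1) by blast
  then have jX: "P ! j \<in> X" "layer (P ! j) = 0" using lits(1) first by auto
  have sel: "j + i < length P \<and> P ! (j + i) \<in> X \<and> layer (P ! (j + i)) = i" if "i < L" for i
    using that
  proof (induction i)
    case 0
    then show ?case using j jX by simp
  next
    case (Suc i)
    then have IH: "j + i < length P" "P ! (j + i) \<in> X" "layer (P ! (j + i)) = i" by auto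
    then have "Suc (j + i) < length P" using last disj(1) by metis
    then show ?case using arc[of "j + i"] IH Suc.prems disj by (auto simp: arcs)
  qed
  show ?thesis
  proof (rule that)
    show "P ! (j + i) \<in> X \<and> layer (P ! (j + i)) = i" if "i < L" for i using sel[OF that] by blast
    fix c assume c: "c \<in> C"
    then obtain k where k: "k < length P" "P ! k \<in> lits c" using hit by blast
    then have kX: "P ! k \<in> X" using lits(1) c by blast
    \<comment> \<open>Otherwise the path would climb from \<open>P ! k\<close> to
      \<open>P ! j\<close>, which is in layer 0.\<close>
    have "j \<le> k"
    proof (rule ccontr)
      assume "\<not> j \<le> k"
      then have "k + (j - k) = j" "0 < j - k" by auto
      with up[OF kX, of "j - k"] show False using j jX disj(1) by auto
    qed
    then have "k = j + (k - j)" by simp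
    moreover have "layer (P ! k) = k - j"
      using up[OF jX(1), of "k - j"] \<open>j \<le> k\<close> k jX kX disj(1) by auto
    ultimately show "\<exists>i < L. P ! (j + i) \<in> lits c"
      using k layer(1)[OF kX] by (intro exI[of _ "k - j"]) auto
  qed
qed

end

section \<open>Computation tableaux\<close>

type_synonym cell = "nat \<times> nat list"

text \<open>
  The cell at offset \<open>p\<close> holds the state and, for every tape, the symbol at distance \<open>p\<close> from its
  head. So the heads always are at offset 0, and the content of a cell after a step is determined by
  its two neighbours, itself and the cell at offset 0.
\<close>

definition cells :: "tm \<Rightarrow> cell set" where
  "cells M = {..<num_states M} \<times> {ss. set ss \<subseteq> {..<num_symbols M} \<and> length ss = num_tapes M}"

definition cell_at :: "config \<Rightarrow> int \<Rightarrow> cell" where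
  "cell_at cf p = (fst cf, map (\<lambda>(h, c). c (h + p)) (snd cf))"

text \<open>The four contents are those at offsets \<open>p - 1\<close>, \<open>p\<close>,
  \<open>p + 1\<close> and 0. If a head moves by d, the cell now at offset \<open>p\<close> was at
  \<open>p + d\<close> before, and the cell just written was at 0.\<close>

definition next_cell :: "tm \<Rightarrow> int \<Rightarrow> cell \<Rightarrow> cell \<Rightarrow> cell \<Rightarrow> cell \<Rightarrow> cell" where
  "next_cell M p a b c e =
     (if fst e = 1 then b
      else let (q, acts) = trans M (fst e) (snd e)
        in (q, map (\<lambda>i. let (s, m) = acts ! i in
             if p + displacement m = 0 then s
             else (case m of Left \<Rightarrow> snd a ! i | Stay \<Rightarrow> snd b ! i | Right \<Rightarrow> snd c ! i)) [0..<num_tapes M]))"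

definition wf_config :: "tm \<Rightarrow> config \<Rightarrow> bool" where
  "wf_config M cf \<longleftrightarrow> fst cf < num_states M \<and> length (snd cf) = num_tapes M \<and>
     (\<forall>tp \<in> set (snd cf). \<forall>i. snd tp i < num_symbols M)"

lemma finite_cells: "finite (cells M)"
  unfolding cells_def by (intro finite_cartesian_product finite_lists_length_eq) auto

lemma cell_at_in_cells: "wf_config M cf \<Longrightarrow> cell_at cf p \<in> cells M"
  by (auto simp: wf_config_def cell_at_def cells_def)

lemma displacement_cases: "displacement m = -1 \<or> displacement m = 0 \<or> displacement m = 1"
  by (cases m) auto

text \<open>The offset only decides whether the cell has just been written, which is possible only
  within distance 1 of the heads.\<close>

lemma next_cell_far:
  assumes "p \<notin> {-1, 0, 1}" "p' \<notin> {-1, 0, 1}"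
  shows "next_cell M p = next_cell M p'"
proof -
  have "p + displacement m = 0 \<longleftrightarrow> p' + displacement m = 0" for m
    using assms by (cases m) auto
  then show ?thesis unfolding next_cell_def fun_eq_iff by simp
qed

lemma wf_tm_trans:
  assumes "wf_tm M" "(q, ss) \<in> cells M"
  obtains q' acts where "trans M q ss = (q', acts)" "q' < num_states M" "length acts = num_tapes M"
    "\<forall>i < num_tapes M. fst (acts ! i) < num_symbols M"
proof -
  obtain q' acts where *: "trans M q ss = (q', acts)" by fastforce
  have "fst (trans M q ss) < num_states M \<and> length (snd (trans M q ss)) = num_tapes M \<and>
        fst ` set (snd (trans M q ss)) \<subseteq> {..<num_symbols M}"
    using assms unfolding wf_tm_def cells_def by simp
  then have "q' < num_states M" "length acts = num_tapes M" "fst ` set acts \<subseteq> {..<num_symbols M}"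
    using * by auto
  moreover have "fst (acts ! i) < num_symbols M" if "i < num_tapes M" for i
    using that calculation by (metis image_eqI lessThan_iff nth_mem subsetD)
  ultimately show ?thesis using that * by blast
qed

lemma next_cell_in_cells:
  assumes "wf_tm M" "a \<in> cells M" "b \<in> cells M" "c \<in> cells M" "e \<in> cells M"
  shows "next_cell M p a b c e \<in> cells M"
proof (cases "fst e = 1")
  case True
  then show ?thesis using assms by (simp add: next_cell_def)
next
  case False
  from assms(5) have "(fst e, snd e) \<in> cells M" by simp
  then obtain q acts where t: "trans M (fst e) (snd e) = (q, acts)" "q < num_states M"
    "length acts = num_tapes M" "\<forall>i < num_tapes M. fst (acts ! i) < num_symbols M"
    by (rule wf_tm_trans[OF assms(1)])
  have sym: "snd d ! i < num_symbols M" if "d \<in> cells M" "i < num_tapes M" for d i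
  proof -
    have "snd d ! i \<in> set (snd d)" using that by (simp add: cells_def mem_Times_iff)
    then show ?thesis using that(1) by (auto simp: cells_def)
  qed
  have "(let (s, m) = acts ! i in if p + displacement m = 0 then s
      else (case m of Left \<Rightarrow> snd a ! i | Stay \<Rightarrow> snd b ! i | Right \<Rightarrow> snd c ! i)) < num_symbols M"
    if "i < num_tapes M" for i
    using t(4) that sym[OF assms(2)] sym[OF assms(3)] sym[OF assms(4)]
    by (simp add: Let_def case_prod_beta split: move.split)
  then show ?thesis
    using False t by (auto simp: next_cell_def cells_def[of M])
qed

lemma tm_step_halted: "fst cf = 1 \<Longrightarrow> tm_step M cf = cf"
  by (cases cf) (simp add: tm_step_def)

lemma tm_step_wf:
  assumes "wf_tm M" "wf_config M cf" "fst cf \<noteq> 1"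
  obtains q acts where "trans M (fst (cell_at cf 0)) (snd (cell_at cf 0)) = (q, acts)"
    "length acts = num_tapes M" "q < num_states M" "\<forall>i < num_tapes M. fst (acts ! i) < num_symbols M"
    "tm_step M cf = (q, map (\<lambda>i. (fst (snd cf ! i) + displacement (snd (acts ! i)),
        (snd (snd cf ! i))(fst (snd cf ! i) := fst (acts ! i)))) [0..<num_tapes M])"
proof -
  obtain q ts where cf: "cf = (q, ts)" by fastforce
  have "(q, map (\<lambda>(h, c). c h) ts) = cell_at cf 0" by (simp add: cf cell_at_def)
  then obtain q' acts where t: "trans M q (map (\<lambda>(h, c). c h) ts) = (q', acts)" "q' < num_states M"
    "length acts = num_tapes M" "\<forall>i < num_tapes M. fst (acts ! i) < num_symbols M"
    using wf_tm_trans[OF assms(1)] cell_at_in_cells[OF assms(2)] by metis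
  have "length ts = num_tapes M" using assms(2) by (simp add: cf wf_config_def)
  then have "tm_step M cf = (q', map (\<lambda>i. (fst (snd cf ! i) + displacement (snd (acts ! i)),
        (snd (snd cf ! i))(fst (snd cf ! i) := fst (acts ! i)))) [0..<num_tapes M])"
    using assms(3) t by (auto simp: tm_step_def cf case_prod_beta intro!: nth_equalityI)
  then show ?thesis using that t by (simp add: cf cell_at_def)
qed

lemma wf_config_step:
  assumes "wf_tm M" "wf_config M cf"
  shows "wf_config M (tm_step M cf)"
proof (cases "fst cf = 1")
  case True
  then show ?thesis using assms by (simp add: tm_step_halted)
next
  case False
  show ?thesis
    by (rule tm_step_wf[OF assms False])
      (use assms(2) in \<open>auto simp: wf_config_def\<close>)
qed

lemma cell_at_step:
  assumes "wf_tm M" "wf_config M cf"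
  shows "cell_at (tm_step M cf) p =
    next_cell M p (cell_at cf (p - 1)) (cell_at cf p) (cell_at cf (p + 1)) (cell_at cf 0)"
proof (cases "fst cf = 1")
  case True
  then show ?thesis by (simp add: tm_step_halted next_cell_def cell_at_def)
next
  case False
  obtain q acts where t: "trans M (fst (cell_at cf 0)) (snd (cell_at cf 0)) = (q, acts)"
    and s: "tm_step M cf = (q, map (\<lambda>i. (fst (snd cf ! i) + displacement (snd (acts ! i)),
        (snd (snd cf ! i))(fst (snd cf ! i) := fst (acts ! i)))) [0..<num_tapes M])"
    by (rule tm_step_wf[OF assms False]) (rule that)
  have l: "length (snd cf) = num_tapes M" using assms(2) by (simp add: wf_config_def)
  have f: "fst (cell_at cf 0) \<noteq> 1" using False by (simp add: cell_at_def)
  have cell: "snd (cell_at cf r) ! i = snd (snd cf ! i) (fst (snd cf ! i) + r)" if "i < num_tapes M" for r i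
    using that l by (simp add: cell_at_def case_prod_beta)
  show ?thesis
    unfolding next_cell_def t using f
    by (auto simp: cell_at_def[of "(_, _)"] s Let_def case_prod_beta cell algebra_simps intro!: nth_equalityI
      split: move.split)
qed

lemma tm_initial_wf:
  assumes "wf_tm M"
  shows "wf_config M (tm_initial M ws)"
proof -
  have "word_tape w i < num_symbols M" "0 < num_states M" for w i
    using assms by (auto simp: word_tape_def wf_tm_def)
  then show ?thesis by (auto simp: wf_config_def tm_initial_def)
qed

definition config_after :: "tm \<Rightarrow> bool list list \<Rightarrow> nat \<Rightarrow> config" where
  "config_after M ws t = (tm_step M ^^ t) (tm_initial M ws)"

lemma config_after_wf: "wf_tm M \<Longrightarrow> wf_config M (config_after M ws t)"
  unfolding config_after_def by (induction t) (simp_all add: tm_initial_wf wf_config_step)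

text \<open>Locates the output: after \<open>t\<close> steps, cell 0 of the last tape is within
  distance \<open>t\<close> of its head.\<close>

lemma config_after_head:
  assumes "wf_tm M" "i < num_tapes M"
  shows "\<bar>fst (snd (config_after M ws t) ! i)\<bar> \<le> int t"
proof (induction t)
  case 0
  then show ?case using assms(2) by (simp add: config_after_def tm_initial_def)
next
  case (Suc t)
  let ?cf = "config_after M ws t"
  have step: "config_after M ws (Suc t) = tm_step M ?cf" by (simp add: config_after_def)
  show ?case
  proof (cases "fst ?cf = 1")
    case True
    then show ?thesis using Suc by (simp add: step tm_step_halted)
  next
    case False
    obtain q acts where
      "tm_step M ?cf = (q, map (\<lambda>i. (fst (snd ?cf ! i) + displacement (snd (acts ! i)),
        (snd (snd ?cf ! i))(fst (snd ?cf ! i) := fst (acts ! i)))) [0..<num_tapes M])"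
      by (rule tm_step_wf[OF assms(1) config_after_wf[OF assms(1)] False]) (rule that)
    then show ?thesis
      using Suc assms(2) displacement_cases[of "snd (acts ! i)"] by (auto simp: step)
  qed
qed

lemma cell_at_initial:
  "cell_at (tm_initial M ws) p =
     (0, map (\<lambda>i. word_tape (if i < length ws then ws ! i else []) p) [0..<num_tapes M])"
  by (simp add: cell_at_def tm_initial_def)

text \<open>The certificate is the second input; it may occupy the cells \<open>C, \<dots>, D - 1\<close>.\<close>

definition initial_cell :: "bool list \<Rightarrow> nat \<Rightarrow> nat \<Rightarrow> nat \<Rightarrow> cell \<Rightarrow> bool" where
  "initial_cell x C D p a \<longleftrightarrow>
     fst a = 0 \<and> snd a ! 0 = word_tape x (int p - int C) \<and>
     (if C \<le> p \<and> p < D then snd a ! 1 \<le> 2 else snd a ! 1 = 0) \<and>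
     (\<forall>i \<in> {2..<length (snd a)}. snd a ! i = 0)"

text \<open>Of the last two conjuncts, the first forbids a nonblank after a blank on the certificate
  tape, so that its contents form a word. The second forbids symbol 1, the bit False, on the last
  tape at time \<open>R\<close>; for a machine that outputs one bit this is acceptance.\<close>

definition tableau :: "tm \<Rightarrow> bool list \<Rightarrow> nat \<Rightarrow> nat \<Rightarrow> (nat \<Rightarrow> nat \<Rightarrow> cell) \<Rightarrow> bool" where
  "tableau M x R P A \<longleftrightarrow>
     (\<forall>t \<le> R. \<forall>p \<le> 4 * R. A t p \<in> cells M) \<and>
     (\<forall>t < R. \<forall>p. 0 < p \<and> p < 4 * R \<longrightarrow> A (Suc t) p =
        next_cell M (int p - int (2 * R)) (A t (p - 1)) (A t p) (A t (Suc p)) (A t (2 * R))) \<and>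
     (\<forall>p \<le> 4 * R. initial_cell x (2 * R) (2 * R + P) p (A 0 p)) \<and>
     (\<forall>p < 4 * R. 2 * R \<le> p \<longrightarrow> snd (A 0 p) ! 1 \<noteq> 0 \<or> snd (A 0 (Suc p)) ! 1 = 0) \<and>
     (\<forall>p \<le> 4 * R. last (snd (A R p)) \<noteq> 1)"

context
  fixes M :: tm and V :: "bool list \<Rightarrow> bool list \<Rightarrow> bool" and x :: "bool list" and R P :: nat
  assumes wf: "wf_tm M" and tapes: "2 \<le> num_tapes M"
    and outputs: "\<And>u. length u \<le> P \<Longrightarrow> tm_outputs_within M [x, u] [V x u] R"
begin

lemma config_after_last:
  assumes "length u \<le> P"
  shows "snd (last (snd (config_after M [x, u] R))) = word_tape [V x u]"
  using outputs[OF assms] by (auto simp: tm_outputs_within_def config_after_def case_prod_beta Let_def)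

lemma certificate_imp_tableau:
  assumes "length u \<le> P" "V x u"
  shows "tableau M x R P (\<lambda>t p. cell_at (config_after M [x, u] t) (int p - int (2 * R)))"
proof -
  let ?A = "\<lambda>t p. cell_at (config_after M [x, u] t) (int p - int (2 * R))"
  have len: "length (snd (config_after M [x, u] t)) = num_tapes M" for t
    using config_after_wf[OF wf] by (simp add: wf_config_def)
  have ini: "cell_at (config_after M [x, u] 0) r =
      (0, map (\<lambda>i. word_tape (if i < 2 then [x, u] ! i else []) r) [0..<num_tapes M])" for r
    by (simp add: config_after_def cell_at_initial)
  have st: "?A (Suc t) p =
        next_cell M (int p - int (2 * R)) (?A t (p - 1)) (?A t p) (?A t (Suc p)) (?A t (2 * R))" if "0 < p" for t p
  proof -
    have o: "int (p - 1) - int (2 * R) = int p - int (2 * R) - 1" "int (Suc p) - int (2 * R) = int p - int (2 * R) + 1"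
      "int (2 * R) - int (2 * R) = 0"
      using that by auto
    have st: "?A (Suc t) p = cell_at (tm_step M (config_after M [x, u] t)) (int p - int (2 * R))"
      by (simp add: config_after_def)
    then show ?thesis
      unfolding o cell_at_step[OF wf config_after_wf[OF wf]] .
  qed
  have in0: "initial_cell x (2 * R) (2 * R + P) p (?A 0 p)" for p
    using tapes assms(1) by (auto simp: initial_cell_def ini word_tape_def)
  have mono: "snd (?A 0 p) ! 1 \<noteq> 0 \<or> snd (?A 0 (Suc p)) ! 1 = 0" if "2 * R \<le> p" for p
    using tapes that by (auto simp: ini word_tape_def)
  have acc: "last (snd (?A R p)) \<noteq> 1" for p
  proof -
    have "snd (config_after M [x, u] R) \<noteq> []" using len[of R] tapes by auto
    then show ?thesis
      using config_after_last[OF assms(1)] assms(2)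
      by (simp add: cell_at_def last_map case_prod_beta word_tape_def)
  qed
  show ?thesis
    unfolding tableau_def
    by (intro conjI allI impI)
      (rule cell_at_in_cells[OF config_after_wf[OF wf]] in0 acc | (erule conjE, erule st) | erule mono)+
qed

lemma tableau_imp_certificate:
  assumes "tableau M x R P A"
  shows "\<exists>u. length u \<le> P \<and> V x u"
proof -
  from assms have cell: "\<And>t p. t \<le> R \<Longrightarrow> p \<le> 4 * R \<Longrightarrow> A t p \<in> cells M"
    and step: "\<And>t p. t < R \<Longrightarrow> 0 < p \<Longrightarrow> p < 4 * R \<Longrightarrow> A (Suc t) p =
        next_cell M (int p - int (2 * R)) (A t (p - 1)) (A t p) (A t (Suc p)) (A t (2 * R))"
    and ini: "\<And>p. p \<le> 4 * R \<Longrightarrow> initial_cell x (2 * R) (2 * R + P) p (A 0 p)"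
    and mono: "\<And>p. p < 4 * R \<Longrightarrow> 2 * R \<le> p \<Longrightarrow> snd (A 0 p) ! 1 \<noteq> 0 \<or> snd (A 0 (Suc p)) ! 1 = 0"
    and acc: "\<And>p. p \<le> 4 * R \<Longrightarrow> last (snd (A R p)) \<noteq> 1"
    by (simp_all add: tableau_def)
  define cert where "cert i = snd (A 0 (2 * R + i)) ! 1" for i
  \<comment> \<open>The certificate ends at the first blank, or fills all \<open>2 * R + 1\<close>
    represented cells.\<close>
  define l where "l = (LEAST i. i = 2 * R + 1 \<or> cert i = 0)"
  have l: "l = 2 * R + 1 \<or> cert l = 0"
    unfolding l_def by (rule LeastI[of _ "2 * R + 1"]) simp
  have l_le: "l \<le> 2 * R + 1" unfolding l_def by (rule Least_le) simp
  have below: "cert i \<noteq> 0" if "i < l" for i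
    using not_less_Least[of i "\<lambda>i. i = 2 * R + 1 \<or> cert i = 0"] that by (simp add: l_def)
  have above: "cert i = 0" if "l \<le> i" "i \<le> 2 * R" for i
    using that
  proof (induction i rule: dec_induct)
    case base
    then show ?case using l by auto
  next
    case (step i)
    then show ?case using mono[of "2 * R + i"] by (auto simp: cert_def)
  qed
  have "l \<le> P"
  proof (rule ccontr)
    assume "\<not> l \<le> P"
    \<comment> \<open>Here \<open>P \<le> 2 * R\<close>, so position \<open>2 * R + P\<close> is
      represented; it is the first one beyond the range of the certificate.\<close>
    then have "cert P = 0" using ini[of "2 * R + P"] l_le by (auto simp: initial_cell_def cert_def)
    then show False using below[of P] \<open>\<not> l \<le> P\<close> by simp
  qed
  define u where "u = map (\<lambda>i. cert i = 2) [0..<l]"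
  have len: "length u \<le> P" using \<open>l \<le> P\<close> by (simp add: u_def)
  have wt: "word_tape u (int i) = cert i" if "i \<le> 2 * R" for i
  proof (cases "i < l")
    case True
    then have "cert i \<noteq> 0" "cert i \<le> 2"
      using below ini[of "2 * R + i"] that by (auto simp: initial_cell_def cert_def split: if_splits)
    then show ?thesis using True by (auto simp: word_tape_def u_def)
  next
    case False
    then show ?thesis using above that by (auto simp: word_tape_def u_def)
  qed
  let ?cf = "config_after M [x, u]"
  have A0: "A 0 p = cell_at (?cf 0) (int p - int (2 * R))" if p: "p \<le> 4 * R" for p
  proof -
    have i: "initial_cell x (2 * R) (2 * R + P) p (A 0 p)" using ini p by blast
    have ls: "length (snd (A 0 p)) = num_tapes M" using cell[of 0 p] p by (auto simp: cells_def)
    have 1: "snd (A 0 p) ! 1 = word_tape u (int p - int (2 * R))"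
    proof (cases "2 * R \<le> p")
      case True
      then show ?thesis using wt[of "p - 2 * R"] p by (simp add: cert_def)
    next
      case False
      then show ?thesis using i by (simp add: initial_cell_def word_tape_def)
    qed
    have "snd (A 0 p) ! j = word_tape (if j < length [x, u] then [x, u] ! j else []) (int p - int (2 * R))"
      if j: "j < num_tapes M" for j
    proof -
      consider "j = 0" | "j = 1" | "2 \<le> j" by linarith
      then show ?thesis
      proof cases
        case 1
        then show ?thesis using i by (simp add: initial_cell_def)
      next
        case 2
        then show ?thesis using 1 by simp
      next
        case 3
        then show ?thesis using i j by (simp add: initial_cell_def ls word_tape_Nil)
      qed
    qed
    then have "snd (A 0 p) =
        map (\<lambda>i. word_tape (if i < length [x, u] then [x, u] ! i else []) (int p - int (2 * R))) [0..<num_tapes M]"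
      by (intro nth_equalityI) (simp_all add: ls)
    moreover have "fst (A 0 p) = 0" using i by (simp add: initial_cell_def)
    ultimately show ?thesis by (simp add: config_after_def cell_at_initial prod_eq_iff)
  qed
  \<comment> \<open>The range of trusted positions loses one at each end per step; position
    \<open>2 * R\<close> stays inside because \<open>t \<le> R\<close>.\<close>
  have At: "A t p = cell_at (?cf t) (int p - int (2 * R))"
    if "t \<le> R" "t \<le> p" "p + t \<le> 4 * R" for t p
    using that
  proof (induction t arbitrary: p)
    case 0
    then show ?case using A0 by simp
  next
    case (Suc t)
    have o: "int (p - 1) - int (2 * R) = int p - int (2 * R) - 1" "int (Suc p) - int (2 * R) = int p - int (2 * R) + 1"
      "int (2 * R) - int (2 * R) = 0"
      using Suc.prems by auto
    have IH: "A t (p - 1) = cell_at (?cf t) (int (p - 1) - int (2 * R))"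
      "A t p = cell_at (?cf t) (int p - int (2 * R))"
      "A t (Suc p) = cell_at (?cf t) (int (Suc p) - int (2 * R))"
      "A t (2 * R) = cell_at (?cf t) (int (2 * R) - int (2 * R))"
      by (rule Suc.IH; use Suc.prems in linarith)+
    have "A (Suc t) p = next_cell M (int p - int (2 * R)) (A t (p - 1)) (A t p) (A t (Suc p)) (A t (2 * R))"
      using step[of t p] Suc.prems by simp
    also have "\<dots> = cell_at (tm_step M (?cf t)) (int p - int (2 * R))"
      unfolding IH o by (rule cell_at_step[OF wf config_after_wf[OF wf], symmetric])
    finally show ?case by (simp add: config_after_def)
  qed
  let ?ts = "snd (?cf R)" and ?i = "num_tapes M - 1"
  define h where "h = fst (?ts ! ?i)"
  have lts: "length ?ts = num_tapes M" using config_after_wf[OF wf] by (simp add: wf_config_def)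
  have ne: "?ts \<noteq> []" using lts tapes by auto
  then have last: "last ?ts = ?ts ! ?i" using lts by (simp add: last_conv_nth)
  have h: "\<bar>h\<bar> \<le> int R" using config_after_head[OF wf, of ?i] tapes by (simp add: h_def)
  \<comment> \<open>The position of offset \<open>- h\<close>, where cell 0 of the last tape is
    found.\<close>
  define p where "p = nat (int (2 * R) - h)"
  have p: "int p - int (2 * R) = - h" "R \<le> p" "p + R \<le> 4 * R" using h by (auto simp: p_def)
  have "last (snd (A R p)) = word_tape [V x u] 0"
    using At[of R p] p ne config_after_last[OF len]
    by (simp add: cell_at_def last_map case_prod_beta last h_def)
  then have "V x u" using acc[of p] p(3) by (simp add: word_tape_def split: if_splits)
  then show ?thesis using len by blast
qed

end

section \<open>Clauses of the tableau\<close>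

lemma testable_if:
  "testable Z P \<Longrightarrow> testable Z Q \<Longrightarrow> testable Z S \<Longrightarrow> testable Z (\<lambda>x s. if P x s then Q x s else S x s)"
  using testable_or[OF testable_and[of Z P Q] testable_and[OF testable_not[of Z P], of S]]
  by (simp add: if_bool_eq_disj)

context
  fixes a b :: nat
  assumes ab: "a \<notin> {1, 2}" "b \<notin> {1, 2}"
begin

lemma testable_comparisons:
  "testable {0, 1, 2} (\<lambda>x s. s a = s b)"
  "testable {0, 1, 2} (\<lambda>x s. s a = Suc (s b))"
  "testable {0, 1, 2} (\<lambda>x s. Suc (s a) = s b)"
  "testable {0, 1, 2} (\<lambda>x s. s a < s b)"
  "testable {0, 1, 2} (\<lambda>x s. s a \<le> s b)"
  using testable_eq[of 2 "{0, 1, 2}" 1 a b 0 0] testable_eq[of 2 "{0, 1, 2}" 1 a b 0 1]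
    testable_eq[of 2 "{0, 1, 2}" 1 a b 1 0] testable_le[of 2 "{0, 1, 2}" 1 a b 1 0]
    testable_le[of 2 "{0, 1, 2}" 1 a b 0 0] ab
  by (simp_all add: Suc_le_eq)

lemma testable_word_tape:
  assumes "a \<noteq> 0" "b \<noteq> 0"
  shows "testable {0, 1, 2} (\<lambda>x s. y = word_tape x (int (s a) - int (s b)))"
proof -
  \<comment> \<open>Register 0 counts input bits from 1, hence \<open>s a + 1\<close>. The case
    \<open>s a < s b\<close> is split off because the register would read the mark there, whereas
    the tape is blank.\<close>
  have "(y = word_tape x (int (s a) - int (s b))) =
    (if s a < s b then y = 0 else head_symbol x 0 ((s a + 1) - (s b + 0)) = y)" for x and s :: store
    by (auto simp: head_symbol_def word_tape_def of_nat_diff algebra_simps)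
  moreover have "testable {0, 1, 2} (\<lambda>x s. if s a < s b then y = 0 else head_symbol x 0 ((s a + 1) - (s b + 0)) = y)"
    by (rule testable_if testable_comparisons testable_const testable_head_symbol[where u = 1])+
      (use ab assms in auto)
  ultimately show ?thesis by simp
qed

text \<open>Only the offsets 0, 1 and -1 have to be told apart; 2 represents all others.\<close>

lemma testable_next_cell:
  "testable {0, 1, 2} (\<lambda>x s. v = next_cell M (int (s a) - int (s b)) c d e f)"
proof -
  let ?n = "\<lambda>i. next_cell M i c d e f"
  have "(v = ?n (int (s a) - int (s b))) =
    (if s a = s b then v = ?n 0 else if s a = Suc (s b) then v = ?n 1
     else if Suc (s a) = s b then v = ?n (-1) else v = ?n 2)" for s :: store
  proof -
    consider "s a = s b" | "s a = Suc (s b)" | "Suc (s a) = s b"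
      | "s a \<noteq> s b" "s a \<noteq> Suc (s b)" "Suc (s a) \<noteq> s b" by blast
    then show ?thesis
    proof cases
      case 3
      then have i: "int (s a) - int (s b) = -1" by simp
      show ?thesis unfolding i using 3 by auto
    next
      case 4
      then have "next_cell M (int (s a) - int (s b)) = next_cell M 2"
        by (intro next_cell_far) auto
      then show ?thesis using 4 by simp
    qed simp_all
  qed
  moreover have "testable {0, 1, 2} (\<lambda>x s. if s a = s b then v = ?n 0 else if s a = Suc (s b) then v = ?n 1
     else if Suc (s a) = s b then v = ?n (-1) else v = ?n 2)"
    by (rule testable_if testable_comparisons testable_const)+
  ultimately show ?thesis by simp
qed

end

text \<open>Every time and position carries one vertex of each kind: the contents to choose from,
  one transition clause per possible neighbourhood, and the clauses for the start, the shape of the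
  certificate and acceptance.\<close>

datatype kind =
    is_Cell: Cell (the_cell: cell)
  | Trans cell cell cell cell
  | Init
  | Cert
  | Acc
  | Sink

definition kinds :: "tm \<Rightarrow> kind set" where
  "kinds M = Cell ` cells M \<union> (\<lambda>(a, b, c, e). Trans a b c e) ` (cells M \<times> cells M \<times> cells M \<times> cells M) \<union>
     {Init, Cert, Acc, Sink}"

lemma finite_kinds: "finite (kinds M)"
  by (simp add: kinds_def finite_cells)

text \<open>
  \<open>B\<close> and \<open>B'\<close> are the numbers of times and of positions, and \<open>C\<close> is the position of the heads.
  The first disjuncts make clauses trivially true at the times and positions that they do not concern.
  The same holds for the \<open>Sink\<close> clauses: only the last of these vertices serves as the sink.
\<close>

primrec literal :: "tm \<Rightarrow> bool list \<Rightarrow> nat \<Rightarrow> nat \<Rightarrow> nat \<Rightarrow> nat \<Rightarrow> nat \<Rightarrow> nat \<Rightarrow> kind \<Rightarrow> nat \<Rightarrow> nat \<Rightarrow> cell \<Rightarrow> bool"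
where
  "literal M x C D B B' t p (Cell a) t' p' v \<longleftrightarrow> False"
| "literal M x C D B B' t p (Trans a b c e) t' p' v \<longleftrightarrow>
     Suc t = B \<or> p = 0 \<or> Suc p = B' \<or>
     t' = t \<and> (Suc p' = p \<and> v \<noteq> a \<or> p' = p \<and> v \<noteq> b \<or> p' = Suc p \<and> v \<noteq> c \<or> p' = C \<and> v \<noteq> e) \<or>
     t' = Suc t \<and> p' = p \<and> v = next_cell M (int p - int C) a b c e"
| "literal M x C D B B' t p Init t' p' v \<longleftrightarrow> t \<noteq> 0 \<or> t' = 0 \<and> p' = p \<and> initial_cell x C D p v"
| "literal M x C D B B' t p Cert t' p' v \<longleftrightarrow>
     t \<noteq> 0 \<or> p < C \<or> Suc p = B' \<or> t' = 0 \<and> (p' = p \<and> snd v ! 1 \<noteq> 0 \<or> p' = Suc p \<and> snd v ! 1 = 0)"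
| "literal M x C D B B' t p Acc t' p' v \<longleftrightarrow> Suc t \<noteq> B \<or> t' = t \<and> p' = p \<and> last (snd v) \<noteq> 1"
| "literal M x C D B B' t p Sink t' p' v \<longleftrightarrow> \<not> (Suc t = B \<and> Suc p = B')"

text \<open>Between contents, arcs lead to the lexicographic successor of (time, position).
  Comparing coordinates avoids computing layer numbers, which are products.\<close>

definition adjacent ::
  "tm \<Rightarrow> bool list \<Rightarrow> nat \<Rightarrow> nat \<Rightarrow> nat \<Rightarrow> nat \<Rightarrow> nat \<Rightarrow> nat \<Rightarrow> kind \<Rightarrow> nat \<Rightarrow> nat \<Rightarrow> kind \<Rightarrow> bool" where
  "adjacent M x C D B B' t p k t' p' k' \<longleftrightarrow>
     (if is_Cell k' then
        (if is_Cell k then t' = t \<and> p' = Suc p \<or> t' = Suc t \<and> Suc p = B' \<and> p' = 0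
         else literal M x C D B B' t p k t' p' (the_cell k'))
      else is_Cell k \<and> k' = Sink \<and> Suc t = B \<and> Suc p = B' \<and> Suc t' = B \<and> Suc p' = B')"

text \<open>
  Registers 1 and 2 are scratch registers, 5 to 8 hold the parameters of the tableau, and 9, 11, 13
  and 15 are loop counters.
\<close>

lemma testable_adjacent:
  "testable {0, 1, 2} (\<lambda>x s. adjacent M x (s 5) (s 6) (s 7) (s 8) (s 9) (s 11) k (s 13) (s 15) k')"
proof -
  have "testable {0, 1, 2} (\<lambda>x s. initial_cell x (s 5) (s 6) (s 11) v)" for v
    unfolding initial_cell_def
    by (intro testable_and testable_if testable_comparisons testable_const testable_word_tape) auto
  then have "testable {0, 1, 2} (\<lambda>x s. literal M x (s 5) (s 6) (s 7) (s 8) (s 9) (s 11) k (s 13) (s 15) v)" for v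
    by (cases k; simp only: literal.simps;
      intro testable_and testable_or testable_not testable_zero testable_comparisons
        testable_const testable_next_cell; simp)
  then show ?thesis
    unfolding adjacent_def
    by (intro testable_and testable_if testable_or testable_zero testable_comparisons testable_const) auto
qed

text \<open>A transition is an implication from four contents to a fifth. As a clause it has four
  negative literals, the negation of a content being all other contents of that place.\<close>

lemma tableau_iff_literal:
  assumes T: "\<And>t p. t \<le> R \<Longrightarrow> p \<le> 4 * R \<Longrightarrow> T t p \<in> cells M"
  shows "tableau M x R P T \<longleftrightarrow>
    (\<forall>t \<le> R. \<forall>p \<le> 4 * R. \<forall>k \<in> kinds M. \<not> is_Cell k \<longrightarrow> \<not> (k = Sink \<and> t = R \<and> p = 4 * R) \<longrightarrow>
      (\<exists>t' \<le> R. \<exists>p' \<le> 4 * R.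
        literal M x (2 * R) (2 * R + P) (R + 1) (4 * R + 1) t p k t' p' (T t' p')))" (is "_ \<longleftrightarrow> ?rhs")
proof
  let ?l = "\<lambda>t p k t' p'. literal M x (2 * R) (2 * R + P) (R + 1) (4 * R + 1) t p k t' p' (T t' p')"
  assume "tableau M x R P T"
  then have tab: "\<And>t p. t < R \<Longrightarrow> 0 < p \<Longrightarrow> p < 4 * R \<Longrightarrow> T (Suc t) p =
        next_cell M (int p - int (2 * R)) (T t (p - 1)) (T t p) (T t (Suc p)) (T t (2 * R))"
    "\<And>p. p \<le> 4 * R \<Longrightarrow> initial_cell x (2 * R) (2 * R + P) p (T 0 p)"
    "\<And>p. p < 4 * R \<Longrightarrow> 2 * R \<le> p \<Longrightarrow> snd (T 0 p) ! 1 \<noteq> 0 \<or> snd (T 0 (Suc p)) ! 1 = 0"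
    "\<And>p. p \<le> 4 * R \<Longrightarrow> last (snd (T R p)) \<noteq> 1"
    by (simp_all add: tableau_def)
  show ?rhs
  proof (intro allI impI ballI)
    fix t p k
    assume tp: "t \<le> R" "p \<le> 4 * R" and k: "\<not> is_Cell k" "\<not> (k = Sink \<and> t = R \<and> p = 4 * R)"
    \<comment> \<open>A trivially true clause contains every pair, in particular the choice at time
      0 and position 0.\<close>
    have triv: "\<exists>t' \<le> R. \<exists>p' \<le> 4 * R. ?l t p k t' p'" if "?l t p k 0 0" using that by blast
    show "\<exists>t' \<le> R. \<exists>p' \<le> 4 * R. ?l t p k t' p'"
    proof (cases k)
      case (Trans a b c e)
      show ?thesis
      proof (cases "t = R \<or> p = 0 \<or> p = 4 * R")
        case True
        then show ?thesis using triv by (auto simp: Trans)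
      next
        case False
        then have r: "t < R" "0 < p" "p < 4 * R" using tp by auto
        consider "T t (p - 1) \<noteq> a" | "T t p \<noteq> b" | "T t (Suc p) \<noteq> c" | "T t (2 * R) \<noteq> e"
          | "T t (p - 1) = a" "T t p = b" "T t (Suc p) = c" "T t (2 * R) = e" by blast
        then show ?thesis
        proof cases
          case 1
          then show ?thesis using r Trans by (intro exI[of _ t] conjI exI[of _ "p - 1"]) auto
        next
          case 2
          then show ?thesis using r Trans by (intro exI[of _ t] conjI exI[of _ p]) auto
        next
          case 3
          then show ?thesis using r Trans by (intro exI[of _ t] conjI exI[of _ "Suc p"]) auto
        next
          case 4
          then show ?thesis using r Trans by (intro exI[of _ t] conjI exI[of _ "2 * R"]) auto
        next
          case 5
          have "T (Suc t) p = next_cell M (int p - int (2 * R)) a b c e"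
            using tab(1)[OF r] unfolding 5 .
          then show ?thesis using r Trans by (intro exI[of _ "Suc t"] conjI exI[of _ p]) auto
        qed
      qed
    next
      case Init
      have "initial_cell x (2 * R) (2 * R + P) p (T 0 p)" using tab(2) tp by blast
      then show ?thesis using tp Init by (intro exI[of _ 0] conjI exI[of _ p]) auto
    next
      case Cert
      show ?thesis
      proof (cases "p < 2 * R \<or> p = 4 * R")
        case True
        then show ?thesis using triv by (auto simp: Cert)
      next
        case False
        then have p: "2 * R \<le> p" "p < 4 * R" using tp by auto
        then consider "snd (T 0 p) ! 1 \<noteq> 0" | "snd (T 0 (Suc p)) ! 1 = 0"
          using tab(3)[of p] by auto
        then show ?thesis
        proof cases
          case 1
          then show ?thesis using p Cert by (intro exI[of _ 0] conjI exI[of _ p]) auto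
        next
          case 2
          then show ?thesis using p Cert by (intro exI[of _ 0] conjI exI[of _ "Suc p"]) auto
        qed
      qed
    next
      case Acc
      have "last (snd (T R p)) \<noteq> 1" using tab(4) tp by blast
      then show ?thesis using tp Acc by (intro exI[of _ t] conjI exI[of _ p]) auto
    qed (use k triv in auto)
  qed
next
  let ?l = "\<lambda>t p k t' p'. literal M x (2 * R) (2 * R + P) (R + 1) (4 * R + 1) t p k t' p' (T t' p')"
  assume rhs: ?rhs
  have l: "\<exists>t' \<le> R. \<exists>p' \<le> 4 * R. ?l t p k t' p'"
    if "t \<le> R" "p \<le> 4 * R" "k \<in> kinds M" "\<not> is_Cell k" "k \<noteq> Sink" for t p k
    using rhs that by blast
  show "tableau M x R P T"
    unfolding tableau_def
  proof (intro conjI allI impI; (elim conjE)?)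
    fix t p assume r: "t < R" "0 < p" "p < 4 * R"
    \<comment> \<open>For the actual neighbourhood all negative literals fail, which leaves the
      successor.\<close>
    let ?k = "Trans (T t (p - 1)) (T t p) (T t (Suc p)) (T t (2 * R))"
    have "?k \<in> kinds M" using r T by (auto simp: kinds_def image_iff)
    then obtain t' p' where "?l t p ?k t' p'" using l[of t p ?k] r by auto
    then show "T (Suc t) p = next_cell M (int p - int (2 * R)) (T t (p - 1)) (T t p) (T t (Suc p)) (T t (2 * R))"
      using r by auto
  next
    fix p assume p: "p \<le> 4 * R"
    then show "initial_cell x (2 * R) (2 * R + P) p (T 0 p)" using l[of 0 p Init] by (auto simp: kinds_def)
  next
    fix p assume p: "p < 4 * R" "2 * R \<le> p"
    then show "snd (T 0 p) ! 1 \<noteq> 0 \<or> snd (T 0 (Suc p)) ! 1 = 0" using l[of 0 p Cert] by (auto simp: kinds_def)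
  next
    fix p assume p: "p \<le> 4 * R"
    then show "last (snd (T R p)) \<noteq> 1" using l[of R p Acc] by (auto simp: kinds_def)
  qed (use T in auto)
qed

section \<open>The graph of a tableau\<close>

lemma concat_map_upt_mult:
  "concat (map f [0..<a * b]) = concat (map (\<lambda>i. concat (map (\<lambda>j. f (i * b + j)) [0..<b])) [0..<a])"
proof (induction a)
  case (Suc a)
  have "[0..<Suc a * b] = [0..<a * b] @ map (\<lambda>j. j + a * b) [0..<b]"
    unfolding map_add_upt using upt_add_eq_append[of 0 "a * b" b] by (simp add: add.commute)
  then show ?case using Suc by (simp add: o_def add.commute)
qed simp

lemma mult_add_div_mod:
  fixes a :: nat
  assumes "j < n"
  shows "(a * n + j) div n = a" "(a * n + j) mod n = j"
  using assms by simp_all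

locale tableau_graph =
  fixes M :: tm and ks :: "kind list" and x :: "bool list" and R P :: nat
  assumes wf: "wf_tm M" and tapes: "2 \<le> num_tapes M"
    and ks: "set ks = kinds M" "distinct ks"
begin

definition width :: nat where
  "width = 4 * R + 1"

lemma Suc_eq_width_iff: "Suc n = width \<longleftrightarrow> n = 4 * R"
  by (simp add: width_def)

definition num_layers :: nat where
  "num_layers = (R + 1) * width"

definition num_verts :: nat where
  "num_verts = num_layers * length ks"

text \<open>Vertex numbers have the digits time, position and index into \<open>ks\<close>, the last
  varying fastest; dropping it gives the layer.\<close>

definition layer_of :: "nat \<Rightarrow> nat" where
  "layer_of v = v div length ks"

definition time_of :: "nat \<Rightarrow> nat" where
  "time_of v = layer_of v div width"

definition pos_of :: "nat \<Rightarrow> nat" where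
  "pos_of v = layer_of v mod width"

definition kind_of :: "nat \<Rightarrow> kind" where
  "kind_of v = ks ! (v mod length ks)"

definition adj :: "nat \<Rightarrow> nat \<Rightarrow> bool" where
  "adj v v' \<longleftrightarrow> adjacent M x (2 * R) (2 * R + P) (R + 1) width
     (time_of v) (pos_of v) (kind_of v) (time_of v') (pos_of v') (kind_of v')"

definition graph :: "nat pair_pre_digraph" where
  "graph = \<lparr>pverts = {0..<num_verts}, parcs = {(v, v'). v < num_verts \<and> v' < num_verts \<and> adj v v'}\<rparr>"

definition vertex :: "nat \<Rightarrow> nat \<Rightarrow> kind \<Rightarrow> nat" where
  "vertex t p k = (t * width + p) * length ks + (SOME i. i < length ks \<and> ks ! i = k)"

lemma length_pos: "0 < length ks"
  using ks(1) by (auto simp: kinds_def)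

lemma layer_bounds:
  assumes "l < num_layers"
  shows "l div width \<le> R" "l mod width \<le> 4 * R"
proof -
  have "l div width < R + 1" using assms unfolding num_layers_def by (rule less_mult_imp_div_less)
  then show "l div width \<le> R" by simp
  have "l mod width < width" by (rule mod_less_divisor) (simp add: width_def)
  then show "l mod width \<le> 4 * R" by (simp add: width_def)
qed

lemma vertex:
  assumes "t \<le> R" "p \<le> 4 * R" "k \<in> kinds M"
  shows "vertex t p k < num_verts" "time_of (vertex t p k) = t" "pos_of (vertex t p k) = p"
    "kind_of (vertex t p k) = k" "layer_of (vertex t p k) = t * width + p"
proof -
  obtain i where i: "i < length ks" "ks ! i = k" using assms(3) ks(1) by (metis in_set_conv_nth)
  define j where "j = (SOME i. i < length ks \<and> ks ! i = k)"
  have j: "j < length ks" "ks ! j = k"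
    using someI[of "\<lambda>i. i < length ks \<and> ks ! i = k", OF conjI[OF i]] by (auto simp: j_def)
  have v: "vertex t p k = (t * width + p) * length ks + j" by (simp add: vertex_def j_def)
  show d: "layer_of (vertex t p k) = t * width + p" unfolding v layer_of_def by (rule mult_add_div_mod(1)[OF j(1)])
  show "kind_of (vertex t p k) = k" unfolding v kind_of_def mult_add_div_mod(2)[OF j(1)] by (rule j(2))
  have p: "p < width" using assms(2) by (simp add: width_def)
  show "time_of (vertex t p k) = t" "pos_of (vertex t p k) = p"
    unfolding time_of_def pos_of_def d by (rule mult_add_div_mod[OF p])+
  have "t * width + p < num_layers" using p mult_le_mono1[OF assms(1), of width]
    unfolding num_layers_def add_mult_distrib mult_1 by linarith
  then have "Suc (t * width + p) * length ks \<le> num_layers * length ks" by (intro mult_le_mono1) simp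
  then show "vertex t p k < num_verts" using j by (simp add: v num_verts_def)
qed

lemma coordinates:
  assumes "v < num_verts"
  shows "time_of v \<le> R" "pos_of v \<le> 4 * R" "kind_of v \<in> kinds M" "v = vertex (time_of v) (pos_of v) (kind_of v)"
    "layer_of v < num_layers"
proof -
  show d: "layer_of v < num_layers"
    using assms by (simp add: num_verts_def layer_of_def less_mult_imp_div_less)
  show "time_of v \<le> R" "pos_of v \<le> 4 * R"
    using layer_bounds[OF d] by (simp_all add: time_of_def pos_of_def)
  have m: "v mod length ks < length ks" using length_pos by simp
  then show "kind_of v \<in> kinds M" using ks(1) nth_mem unfolding kind_of_def by blast
  have "(SOME i. i < length ks \<and> ks ! i = kind_of v) = v mod length ks"
    by (rule some_equality) (use m ks(2) nth_eq_iff_index_eq in \<open>auto simp: kind_of_def\<close>)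
  then show "v = vertex (time_of v) (pos_of v) (kind_of v)"
    unfolding vertex_def time_of_def pos_of_def by (simp only: div_mult_mod_eq layer_of_def)
qed

abbreviation "sink \<equiv> vertex R (4 * R) Sink"

definition path_verts :: "nat set" where
  "path_verts = {v. v < num_verts \<and> is_Cell (kind_of v)}"

definition constraint_verts :: "nat set" where
  "constraint_verts = {v. v < num_verts \<and> \<not> is_Cell (kind_of v) \<and> v \<noteq> sink}"

lemma Sink_in_kinds: "Sink \<in> kinds M"
  by (simp add: kinds_def)

lemma sink_iff:
  assumes "v < num_verts"
  shows "v = sink \<longleftrightarrow> kind_of v = Sink \<and> time_of v = R \<and> pos_of v = 4 * R"
  using coordinates(4)[OF assms] vertex(2-4)[OF le_refl le_refl Sink_in_kinds] by metis

lemma layer_Suc_iff: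
  assumes "v < num_verts" "v' < num_verts"
  shows "layer_of v' = Suc (layer_of v) \<longleftrightarrow>
    time_of v' = time_of v \<and> pos_of v' = Suc (pos_of v) \<or>
    time_of v' = Suc (time_of v) \<and> Suc (pos_of v) = width \<and> pos_of v' = 0" (is "?l' = Suc ?l \<longleftrightarrow> _")
proof
  assume "?l' = Suc ?l"
  then show "time_of v' = time_of v \<and> pos_of v' = Suc (pos_of v) \<or>
    time_of v' = Suc (time_of v) \<and> Suc (pos_of v) = width \<and> pos_of v' = 0"
    by (auto simp: div_Suc mod_Suc time_of_def pos_of_def)
next
  have *: "?l' = time_of v' * width + pos_of v'" "?l = time_of v * width + pos_of v"
    by (simp_all only: time_of_def pos_of_def div_mult_mod_eq)
  assume "time_of v' = time_of v \<and> pos_of v' = Suc (pos_of v) \<or>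
    time_of v' = Suc (time_of v) \<and> Suc (pos_of v) = width \<and> pos_of v' = 0"
  then show "?l' = Suc ?l" unfolding * by auto
qed

lemma last_layer_iff:
  assumes "v < num_verts"
  shows "Suc (layer_of v) = num_layers \<longleftrightarrow> time_of v = R \<and> pos_of v = 4 * R" (is "Suc ?l = _ \<longleftrightarrow> _")
proof
  assume "Suc ?l = num_layers"
  then have "?l = R * width + 4 * R" by (simp add: num_layers_def width_def)
  then show "time_of v = R \<and> pos_of v = 4 * R"
    using mult_add_div_mod[of "4 * R" width R] by (simp add: time_of_def pos_of_def width_def)
next
  assume *: "time_of v = R \<and> pos_of v = 4 * R"
  have "?l = time_of v * width + pos_of v" by (simp only: time_of_def pos_of_def div_mult_mod_eq)
  then show "Suc ?l = num_layers" using * by (simp add: num_layers_def width_def)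
qed

text \<open>The initial configuration with a blank certificate tape is a witness; its blank also
  serves the \<open>Cert\<close> clauses.\<close>

lemma ex_initial_cell:
  obtains a where "a \<in> cells M" "initial_cell x C D p a" "snd a ! 1 = 0" "length (snd a) = num_tapes M"
proof -
  let ?a = "cell_at (tm_initial M [x]) (int p - int C)"
  have "?a \<in> cells M" using cell_at_in_cells tm_initial_wf wf by blast
  moreover have "initial_cell x C D p ?a" "snd ?a ! 1 = 0" "length (snd ?a) = num_tapes M"
    using tapes by (auto simp: cell_at_initial initial_cell_def word_tape_Nil)
  ultimately show ?thesis using that by blast
qed

lemma ex_nonrejecting_cell:
  obtains a where "a \<in> cells M" "last (snd a) \<noteq> 1"
proof
  show "(0, replicate (num_tapes M) 0) \<in> cells M" "last (snd (0, replicate (num_tapes M) 0 :: nat list)) \<noteq> 1"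
    using wf tapes by (auto simp: cells_def wf_tm_def)
qed

text \<open>A clause without literals would be an isolated vertex of the graph. Each clause is
  satisfiable by itself, whether or not all of them are together.\<close>

lemma ex_literal:
  assumes "v \<in> constraint_verts"
  shows "\<exists>v' \<in> path_verts. adj v v'"
proof -
  let ?t = "time_of v" and ?p = "pos_of v" and ?k = "kind_of v"
  from assms have v: "v < num_verts" "\<not> is_Cell ?k" "v \<noteq> sink" by (auto simp: constraint_verts_def)
  note c = coordinates[OF v(1)]
  have intro: ?thesis if "t' \<le> R" "p' \<le> 4 * R" "a \<in> cells M"
    "literal M x (2 * R) (2 * R + P) (R + 1) width ?t ?p ?k t' p' a" for t' p' a
  proof -
    have "Cell a \<in> kinds M" using that(3) by (simp add: kinds_def)
    note w = vertex[OF that(1,2) this]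
    have "vertex t' p' (Cell a) \<in> path_verts" using w by (simp add: path_verts_def)
    moreover have "adj v (vertex t' p' (Cell a))" using that(4) v(2) by (simp add: adj_def adjacent_def w)
    ultimately show ?thesis by blast
  qed
  show ?thesis
  proof (cases ?k)
    case (Cell a)
    then show ?thesis using v(2) by simp
  next
    case (Trans a b c' e)
    then have abce: "a \<in> cells M" "b \<in> cells M" "c' \<in> cells M" "e \<in> cells M"
      using c(3) by (auto simp: kinds_def)
    show ?thesis
    proof (cases "Suc ?t = R + 1")
      case True
      show ?thesis by (rule intro[OF c(1,2) abce(1)]) (use True Trans in simp)
    next
      case False
      \<comment> \<open>The positive literal is used; well-formedness of the machine makes the
        computed content a legal cell.\<close>
      show ?thesis
        by (rule intro[of "Suc ?t" ?p, OF _ c(2) next_cell_in_cells[OF wf abce, of "int ?p - int (2 * R)"]])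
          (use False Trans c(1) in auto)
    qed
  next
    case Init
    obtain a where a: "a \<in> cells M" "initial_cell x (2 * R) (2 * R + P) ?p a" by (rule ex_initial_cell)
    show ?thesis by (rule intro[of 0 ?p a]) (use a c Init in auto)
  next
    case Cert
    obtain a where a: "a \<in> cells M" "snd a ! 1 = 0" by (rule ex_initial_cell)
    show ?thesis
    proof (cases "?p = 4 * R")
      case True
      show ?thesis by (rule intro[of 0 0 a]) (use a True Cert in \<open>auto simp: width_def\<close>)
    next
      case False
      show ?thesis by (rule intro[of 0 "Suc ?p" a]) (use a False Cert c in auto)
    qed
  next
    case Acc
    obtain a where a: "a \<in> cells M" "last (snd a) \<noteq> 1" by (rule ex_nonrejecting_cell)
    show ?thesis by (rule intro[of ?t ?p a]) (use a Acc c in auto)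
  next
    case Sink
    obtain a where a: "a \<in> cells M" by (rule ex_nonrejecting_cell)
    show ?thesis by (rule intro[of 0 0 a]) (use a Sink v sink_iff in \<open>auto simp: Suc_eq_width_iff\<close>)
  qed
qed

text \<open>The \<open>Init\<close> clause of position 0 at time 0 acts as \<open>first\<close>, for
  its literals lie at this very place, which is layer 0. Trivially true clauses have all of
  \<open>path_verts\<close> as literals.\<close>

sublocale layered: layered_digraph graph path_verts constraint_verts sink "vertex 0 0 Init"
  layer_of "num_layers" "\<lambda>v. {v' \<in> path_verts. adj v v'}"
proof
  have sink: "sink < num_verts" "kind_of sink = Sink" using vertex[of R "4 * R" Sink] Sink_in_kinds by auto
  show "pverts graph = insert sink (path_verts \<union> constraint_verts)"
    using sink by (auto simp: graph_def path_verts_def constraint_verts_def)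
  show "finite path_verts" "finite constraint_verts" by (auto simp: path_verts_def constraint_verts_def)
  show "sink \<notin> path_verts" "sink \<notin> constraint_verts" "path_verts \<inter> constraint_verts = {}"
    using sink by (auto simp: path_verts_def constraint_verts_def)
  have 1: "adj u v \<longleftrightarrow> layer_of v = Suc (layer_of u)" if "u \<in> path_verts" "v \<in> path_verts" for u v
    using that layer_Suc_iff[of u v] by (simp add: path_verts_def adj_def adjacent_def)
  have 2: "adj u v \<longleftrightarrow> u \<in> path_verts \<and> Suc (layer_of u) = num_layers \<and> v = sink"
    if "u < num_verts" "v < num_verts" "v \<notin> path_verts" for u v
    using that last_layer_iff[of u] sink_iff[of v] by (auto simp: path_verts_def adj_def adjacent_def Suc_eq_width_iff)
  \<comment> \<open>The last time and position is the only place where \<open>literal\<close> is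
    false for the kind \<open>Sink\<close>.\<close>
  have 3: "\<not> adj sink v" if "v \<in> path_verts" for v
    using that vertex[of R "4 * R" Sink] Sink_in_kinds by (simp add: path_verts_def adj_def adjacent_def Suc_eq_width_iff)
  have sub: "path_verts \<subseteq> {..<num_verts}" by (auto simp: path_verts_def)
  have part: "u \<in> path_verts \<or> u = sink \<or> u \<in> constraint_verts" if "u < num_verts" for u
    using that by (auto simp: path_verts_def constraint_verts_def)
  have cv: "u < num_verts \<and> u \<notin> path_verts" if "u \<in> constraint_verts" for u
    using that by (auto simp: path_verts_def constraint_verts_def)
  show "parcs graph =
    {(u, v). u \<in> path_verts \<and> v \<in> path_verts \<and> layer_of v = Suc (layer_of u)} \<union>
    {(u, v). u \<in> path_verts \<and> Suc (layer_of u) = num_layers \<and> v = sink} \<union>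
    {(c, v). c \<in> constraint_verts \<and> v \<in> {v' \<in> path_verts. adj c v'}}" (is "_ = ?rhs")
  proof (rule set_eqI, clarify)
    fix u v
    show "(u, v) \<in> parcs graph \<longleftrightarrow> (u, v) \<in> ?rhs"
    proof (cases "u < num_verts \<and> v < num_verts")
      case False
      then show ?thesis using sub cv sink by (auto simp: graph_def)
    next
      case True
      then show ?thesis
        using 1[of u v] 2[of u v] 3[of v] part[of u] cv[of u] \<open>sink \<notin> path_verts\<close>
        by (cases "v \<in> path_verts") (auto simp: graph_def)
    qed
  qed
  show "{v' \<in> path_verts. adj c v'} \<subseteq> path_verts" "{v' \<in> path_verts. adj c v'} \<noteq> {}"
    if "c \<in> constraint_verts" for c
    using ex_literal[OF that] by auto
  show "layer_of u < num_layers" if "u \<in> path_verts" for u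
    using that coordinates(5) by (simp add: path_verts_def)
  show "\<exists>u \<in> path_verts. layer_of u = i" if i: "i < num_layers" for i
  proof -
    obtain a where a: "a \<in> cells M" by (rule ex_nonrejecting_cell)
    have "i div width \<le> R" using layer_bounds[OF i] by simp
    moreover have "i mod width \<le> 4 * R" using layer_bounds[OF i] by simp
    ultimately show ?thesis
      using vertex[of "i div width" "i mod width" "Cell a"] a
      by (intro bexI[of _ "vertex (i div width) (i mod width) (Cell a)"]) (auto simp: path_verts_def kinds_def)
  qed
  have init: "vertex 0 0 Init < num_verts" "kind_of (vertex 0 0 Init) = Init"
    "time_of (vertex 0 0 Init) = 0" "pos_of (vertex 0 0 Init) = 0"
    using vertex[of 0 0 Init] by (auto simp: kinds_def)
  show "vertex 0 0 Init \<in> constraint_verts"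
    using init sink(2) by (auto simp: constraint_verts_def)
  show "layer_of u = 0" if "u \<in> {v' \<in> path_verts. adj (vertex 0 0 Init) v'}" for u
  proof -
    from that have "time_of u = 0" "pos_of u = 0"
      using init by (auto simp: path_verts_def adj_def adjacent_def)
    then show ?thesis unfolding time_of_def pos_of_def by (metis add_0 div_mult_mod_eq mult_0)
  qed
qed

lemma graph_in_instances: "graph \<in> weakly_connected_digraphs"
  using layered.pair_digraph layered.connected
  by (auto simp: weakly_connected_digraphs_def graph_def)

text \<open>Passes from a choice indexed by layers to one indexed by time and position; the
  constraint vertices become the clauses of \<open>tableau_iff_literal\<close>.\<close>

lemma hit_iff:
  assumes A: "\<And>i. i < num_layers \<Longrightarrow> A i \<in> path_verts \<and> layer_of (A i) = i"
    and T: "\<And>i. i < num_layers \<Longrightarrow> kind_of (A i) = Cell (T (i div width) (i mod width))"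
  shows "(\<forall>c \<in> constraint_verts. \<exists>i < num_layers. A i \<in> {v' \<in> path_verts. adj c v'}) \<longleftrightarrow> tableau M x R P T"
proof -
  let ?l = "\<lambda>t p k t' p'. literal M x (2 * R) (2 * R + P) (R + 1) width t p k t' p' (T t' p')"
  have idx: "t * width + p < num_layers" if "t \<le> R" "p \<le> 4 * R" for t p
    using vertex(5)[OF that Sink_in_kinds] vertex(1)[OF that Sink_in_kinds] coordinates(5) by metis
  have cell: "T t p \<in> cells M" if "t \<le> R" "p \<le> 4 * R" for t p
  proof -
    have "kind_of (A (t * width + p)) = Cell (T t p)" 
      using T[OF idx[OF that]] mult_add_div_mod[of p width t] that by (simp add: width_def)
    moreover have "kind_of (A (t * width + p)) \<in> kinds M"
      using A[OF idx[OF that]] coordinates(3) by (auto simp: path_verts_def)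
    ultimately show ?thesis by (auto simp: kinds_def)
  qed
  have one: "(\<exists>i < num_layers. A i \<in> {v' \<in> path_verts. adj c v'}) \<longleftrightarrow>
    (\<exists>t' \<le> R. \<exists>p' \<le> 4 * R. ?l (time_of c) (pos_of c) (kind_of c) t' p')" if c: "c \<in> constraint_verts" for c
  proof -
    have nc: "\<not> is_Cell (kind_of c)" using c by (simp add: constraint_verts_def)
    have e: "adj c (A i) \<longleftrightarrow> ?l (time_of c) (pos_of c) (kind_of c) (i div width) (i mod width)" if "i < num_layers" for i
      using A[OF that] T[OF that] nc by (simp add: adj_def adjacent_def time_of_def pos_of_def)
    show ?thesis
    proof
      assume "\<exists>i < num_layers. A i \<in> {v' \<in> path_verts. adj c v'}"
      then obtain i where i: "i < num_layers" "adj c (A i)" by blast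
      have "i div width \<le> R" using layer_bounds[OF i(1)] by simp
      moreover have "i mod width \<le> 4 * R" using layer_bounds[OF i(1)] by simp
      ultimately show "\<exists>t' \<le> R. \<exists>p' \<le> 4 * R. ?l (time_of c) (pos_of c) (kind_of c) t' p'"
        using e[OF i(1)] i(2) by blast
    next
      assume "\<exists>t' \<le> R. \<exists>p' \<le> 4 * R. ?l (time_of c) (pos_of c) (kind_of c) t' p'"
      then obtain t' p' where tp: "t' \<le> R" "p' \<le> 4 * R" "?l (time_of c) (pos_of c) (kind_of c) t' p'" by blast
      then have "adj c (A (t' * width + p'))" 
      using e[OF idx[OF tp(1,2)]] mult_add_div_mod[of p' width t'] by (simp add: width_def)
      then show "\<exists>i < num_layers. A i \<in> {v' \<in> path_verts. adj c v'}"
        using A idx[OF tp(1,2)] by blast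
    qed
  qed
  have "(\<forall>c \<in> constraint_verts. \<exists>i < num_layers. A i \<in> {v' \<in> path_verts. adj c v'}) \<longleftrightarrow>
    (\<forall>c \<in> constraint_verts. \<exists>t' \<le> R. \<exists>p' \<le> 4 * R. ?l (time_of c) (pos_of c) (kind_of c) t' p')"
    using one by (intro ball_cong refl)
  also have "\<dots> \<longleftrightarrow> (\<forall>t \<le> R. \<forall>p \<le> 4 * R. \<forall>k \<in> kinds M. \<not> is_Cell k \<longrightarrow> \<not> (k = Sink \<and> t = R \<and> p = 4 * R) \<longrightarrow>
      (\<exists>t' \<le> R. \<exists>p' \<le> 4 * R. ?l t p k t' p'))" (is "?L \<longleftrightarrow> ?R")
  proof
    assume L: ?L
    show ?R
    proof (intro allI impI ballI)
      fix t p k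
      assume a: "t \<le> R" "p \<le> 4 * R" "k \<in> kinds M" "\<not> is_Cell k" "\<not> (k = Sink \<and> t = R \<and> p = 4 * R)"
      note v = vertex[OF a(1-3)]
      have "vertex t p k \<in> constraint_verts"
        using v a(4,5) sink_iff[OF v(1)] by (simp add: constraint_verts_def)
      then show "\<exists>t' \<le> R. \<exists>p' \<le> 4 * R. ?l t p k t' p'" using L v by fastforce
    qed
  next
    assume R: ?R
    show ?L
    proof
      fix c assume c: "c \<in> constraint_verts"
      then have "c < num_verts" by (simp add: constraint_verts_def)
      then show "\<exists>t' \<le> R. \<exists>p' \<le> 4 * R. ?l (time_of c) (pos_of c) (kind_of c) t' p'"
        using R coordinates[of c] sink_iff[of c] c by (simp add: constraint_verts_def)
    qed
  qed
  also have "\<dots> \<longleftrightarrow> tableau M x R P T"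
    using tableau_iff_literal[of R T M, OF cell] by (simp add: width_def)
  finally show ?thesis .
qed

lemma central_path_iff_tableau:
  "(\<exists>p \<in> shortest_paths graph. max_closeness graph p \<le> 1) \<longleftrightarrow> (\<exists>T. tableau M x R P T)"
proof
  assume "\<exists>p \<in> shortest_paths graph. max_closeness graph p \<le> 1"
  then obtain p where p: "p \<in> shortest_paths graph" "max_closeness graph p \<le> 1" by blast
  obtain A where A: "\<And>i. i < num_layers \<Longrightarrow> A i \<in> path_verts \<and> layer_of (A i) = i"
    and hit: "\<And>c. c \<in> constraint_verts \<Longrightarrow> \<exists>i < num_layers. A i \<in> {v' \<in> path_verts. adj c v'}"
    using layered.path_imp_selection[OF p] by blast
  \<comment> \<open>With the index split into quotient and remainder, the contents have the form
    that \<open>hit_iff\<close> expects.\<close>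
  have "kind_of (A i) = Cell (the_cell (kind_of (A (i div width * width + i mod width))))" if "i < num_layers" for i
    using A[OF that] by (simp only: div_mult_mod_eq) (simp add: path_verts_def)
  then have "tableau M x R P (\<lambda>t p. the_cell (kind_of (A (t * width + p))))"
    using hit_iff[of A "\<lambda>t p. the_cell (kind_of (A (t * width + p)))"] A hit by blast
  then show "\<exists>T. tableau M x R P T" by blast
next
  assume "\<exists>T. tableau M x R P T"
  then obtain T where T: "tableau M x R P T" by blast
  define A where "A i = vertex (i div width) (i mod width) (Cell (T (i div width) (i mod width)))" for i
  have A: "(A i \<in> path_verts \<and> layer_of (A i) = i) \<and> kind_of (A i) = Cell (T (i div width) (i mod width))"
    if i: "i < num_layers" for i
  proof -
    have 1: "i div width \<le> R" using layer_bounds[OF i] by simp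
    have 2: "i mod width \<le> 4 * R" using layer_bounds[OF i] by simp
    have "Cell (T (i div width) (i mod width)) \<in> kinds M" using T 1 2 by (simp add: tableau_def kinds_def)
    from vertex[OF 1 2 this] show ?thesis
      unfolding A_def path_verts_def by (simp only: div_mult_mod_eq) simp
  qed
  have "\<forall>c \<in> constraint_verts. \<exists>i < num_layers. A i \<in> {v' \<in> path_verts. adj c v'}"
    using hit_iff[of A T] A T by blast
  then show "\<exists>p \<in> shortest_paths graph. max_closeness graph p \<le> 1"
    using layered.selection_imp_path[of A] A by blast
qed

end

section \<open>The reduction\<close>

text \<open>The innermost iteration is over a fixed list and is unrolled in the program; only the
  other two become loops.\<close>

definition grid :: "'a list \<Rightarrow> nat \<Rightarrow> nat \<Rightarrow> (nat \<Rightarrow> nat \<Rightarrow> 'a \<Rightarrow> bool list) \<Rightarrow> bool list" where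
  "grid ks a b f = concat (map (\<lambda>t. concat (map (\<lambda>p. concat (map (f t p) ks)) [0..<b])) [0..<a])"

lemma concat_map_nth: "concat (map f ks) = concat (map (\<lambda>i. f (ks ! i)) [0..<length ks])"
proof -
  have "map f ks = map f (map ((!) ks) [0..<length ks])" by (simp only: map_nth)
  then show ?thesis by (simp add: o_def)
qed

lemma concat_map_singleton: "concat (map (\<lambda>x. [f x]) xs) = map f xs"
  by (induction xs) auto

context tableau_graph
begin

lemma concat_map_grid:
  "concat (map (\<lambda>v. f (time_of v) (pos_of v) (kind_of v)) [0..<num_verts]) = grid ks (R + 1) width f"
proof -
  have "f (time_of ((t * width + p) * length ks + i)) (pos_of ((t * width + p) * length ks + i))
      (kind_of ((t * width + p) * length ks + i)) = f t p (ks ! i)"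
    if "p < width" "i < length ks" for t p i
    unfolding time_of_def pos_of_def layer_of_def kind_of_def mult_add_div_mod[OF that(2)]
      mult_add_div_mod[OF that(1)] ..
  then show ?thesis
    unfolding num_verts_def num_layers_def grid_def concat_map_upt_mult concat_map_nth[of "f _ _"]
    by (intro arg_cong[of _ _ concat] map_cong refl) auto
qed

lemma encode_graph:
  "encode_instance graph 1 =
    grid ks (R + 1) (4 * R + 1) (\<lambda>t p k. [True]) @ [False] @
    grid ks (R + 1) (4 * R + 1) (\<lambda>t p k. grid ks (R + 1) (4 * R + 1) (\<lambda>t' p' k'.
      [adjacent M x (2 * R) (2 * R + P) (R + 1) (4 * R + 1) t p k t' p' k'])) @ [True]"
proof -
  let ?a = "adjacent M x (2 * R) (2 * R + P) (R + 1) width"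
  have "card (pverts graph) = num_verts" by (simp add: graph_def)
  moreover have "replicate num_verts True = grid ks (R + 1) width (\<lambda>t p k. [True])"
    unfolding concat_map_grid[symmetric] by (simp add: concat_map_singleton map_replicate_const)
  moreover have "concat (map (\<lambda>i. concat (map (\<lambda>j. [(i, j) \<in> parcs graph]) [0..<num_verts])) [0..<num_verts]) =
    grid ks (R + 1) width (\<lambda>t p k. grid ks (R + 1) width (\<lambda>t' p' k'. [?a t p k t' p' k']))"
    unfolding concat_map_grid[symmetric]
    by (intro arg_cong[of _ _ concat] map_cong refl) (auto simp: graph_def adj_def)
  moreover have "map (bit (1 :: nat)) [0..<floorlog 2 1] = [True]"
    by (simp add: floorlog_def bit_0)
  ultimately show ?thesis
    unfolding encode_instance_def Let_def width_def by (simp add: concat_map_singleton)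
qed

end

lemma emittable_grid:
  assumes "\<And>k. k \<in> set ks \<Longrightarrow> emittable Z (f k)"
    and dep: "\<And>k x s v. f k x (s(j := v)) = f k x s" "\<And>k x s v. f k x (s(j' := v)) = f k x s"
    and "distinct [i, j, i', j', a, b, 1]" "{i, j, i', j'} \<inter> Z = {}" "{i, j, i', j', 1} \<union> Z \<subseteq> Z'"
  shows "emittable Z' (\<lambda>x s. grid ks (s a) (s b) (\<lambda>t p k. f k x (s(i := t, i' := p))))"
proof -
  have 1: "emittable Z (\<lambda>x s. concat (map (\<lambda>k. f k x s) ks))"
    using assms(1) by (rule emittable_concat_map)
  have 2: "emittable ({i', j', 1} \<union> Z) (\<lambda>x s. concat (map (\<lambda>p. concat (map (\<lambda>k. f k x (s(i' := p))) ks)) [0..<s b]))"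
    by (rule emittable_for[OF 1, where j = j' and u = 1]) (use assms(4,5) dep in auto)
  have tw: "s(j := v, i' := p) = s(i' := p, j := v)" for s :: store and v p
    using assms(4) by (auto simp: fun_eq_iff)
  have "emittable Z' (\<lambda>x s. concat (map (\<lambda>t. concat (map (\<lambda>p. concat (map (\<lambda>k. f k x (s(i := t, i' := p))) ks))
      [0..<(s(i := t)) b])) [0..<s a]))"
    by (rule emittable_for[OF 2, where j = j and u = 1]) (use assms(4-6) dep in \<open>auto simp: tw\<close>)
  moreover have "b \<noteq> i" using assms(4) by auto
  ultimately show ?thesis by (simp add: grid_def)
qed

text \<open>Each of the coordinate registers 9, 11, 13 and 15 is followed by the register that
  counts down for it; the first two describe the row, the others the column.\<close>

lemma emittable_encoding:
  "emittable {0, 1, 2, 9, 10, 11, 12, 13, 14, 15, 16} (\<lambda>x s.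
    grid ks (s 7) (s 8) (\<lambda>t p k. [True]) @ [False] @
    grid ks (s 7) (s 8) (\<lambda>t p k. grid ks (s 7) (s 8) (\<lambda>t' p' k'.
      [adjacent M x (s 5) (s 6) (s 7) (s 8) t p k t' p' k'])) @ [True])"
proof (intro emittable_append emittable_const)
  let ?Z = "{0, 1, 2, 9, 10, 11, 12, 13, 14, 15, 16} :: nat set"
  have "emittable ?Z (\<lambda>x s. grid ks (s 7) (s 8) (\<lambda>t p k. (\<lambda>_ _. [True]) x (s(9 := t, 11 := p))))"
    by (rule emittable_grid[where j = 10 and j' = 12 and Z = "{}"]) (auto intro: emittable_const)
  then show "emittable ?Z (\<lambda>x s. grid ks (s 7) (s 8) (\<lambda>t p k. [True]))" by simp
  define e where "e k k' x s = [adjacent M x (s 5) (s 6) (s 7) (s 8) (s 9) (s 11) k (s 13) (s 15) k']"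
    for k k' x and s :: store
  have e: "emittable {0, 1, 2} (e k k')" for k k'
    unfolding e_def by (rule emittable_bit[OF testable_adjacent])
  define g where "g k x s = grid ks (s 7) (s 8) (\<lambda>t p k'. e k k' x (s(13 := t, 15 := p)))"
    for k x and s :: store
  have g: "emittable {0, 1, 2, 13, 14, 15, 16} (g k)" for k
    unfolding g_def by (rule emittable_grid[where j = 14 and j' = 16, OF e]) (auto simp: e_def)
  have "emittable ?Z (\<lambda>x s. grid ks (s 7) (s 8) (\<lambda>t p k. g k x (s(9 := t, 11 := p))))"
    by (rule emittable_grid[where j = 10 and j' = 12, OF g]) (auto simp: e_def g_def)
  then show "emittable ?Z (\<lambda>x s. grid ks (s 7) (s 8) (\<lambda>t p k. grid ks (s 7) (s 8) (\<lambda>t' p' k'.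
      [adjacent M x (s 5) (s 6) (s 7) (s 8) t p k t' p' k'])))"
    by (simp add: g_def e_def)
qed

text \<open>Membership in the decision version only provides some instance and threshold with the
  given code, so the code must determine them. Its unary prefix fixes the number of vertices and
  thereby where the matrix ends.\<close>

lemma encode_instance_eq_1:
  assumes "encode_instance I k = encode_instance G 1"
    and "I \<in> weakly_connected_digraphs" "G \<in> weakly_connected_digraphs"
  shows "I = G \<and> k = 1"
proof -
  have verts: "pverts H = {0..<card (pverts H)} \<and> parcs H \<subseteq> pverts H \<times> pverts H"
    if "H \<in> weakly_connected_digraphs" for H
  proof -
    from that have "pair_digraph H" "\<exists>n. pverts H = {0..<n}" by (auto simp: weakly_connected_digraphs_def)
    then interpret pair_digraph H by simp
    obtain n where "pverts H = {0..<n}" using \<open>\<exists>n. pverts H = {0..<n}\<close> by blast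
    moreover have "parcs H \<subseteq> pverts H \<times> pverts H" using in_arcsD1 in_arcsD2 by auto
    ultimately show ?thesis by simp
  qed
  define mat where "mat H n = map (\<lambda>i. map (\<lambda>j. (i, j) \<in> parcs H) [0..<n]) [0..<n]" for H :: "nat pair_pre_digraph" and n
  have enc: "encode_instance H l = replicate (card (pverts H)) True @ False #
      concat (mat H (card (pverts H))) @ map (bit l) [0..<floorlog 2 l]" for H l
    by (simp add: encode_instance_def mat_def Let_def concat_map_singleton)
  have len: "length (concat (mat H n)) = n * n" for H n
    by (simp add: mat_def length_concat o_def sum_list_triv)
  have tw: "takeWhile id (replicate n True @ False # w) = replicate n True" for n w
    by (induction n) auto
  have "replicate (card (pverts I)) True = replicate (card (pverts G)) True"
    using arg_cong[OF assms(1), of "takeWhile id"] unfolding enc tw .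
  then have n: "card (pverts I) = card (pverts G)" by (metis length_replicate)
  then have *: "concat (mat I (card (pverts G))) = concat (mat G (card (pverts G)))"
    "map (bit k) [0..<floorlog 2 k] = map (bit (1 :: nat)) [0..<floorlog 2 1]"
    using assms(1) by (simp_all add: enc len append_eq_append_conv)
  have "mat I (card (pverts G)) = mat G (card (pverts G))"
    using *(1) by (rule concat_injective) (auto simp: mat_def set_zip)
  then have "(i, j) \<in> parcs I \<longleftrightarrow> (i, j) \<in> parcs G" if "i < card (pverts G)" "j < card (pverts G)" for i j
    using that by (auto simp: mat_def)
  moreover have sub: "parcs I \<subseteq> {0..<card (pverts G)} \<times> {0..<card (pverts G)}"
    "parcs G \<subseteq> {0..<card (pverts G)} \<times> {0..<card (pverts G)}"
    using verts[OF assms(2)] verts[OF assms(3)] n by metis+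
  ultimately have "parcs I = parcs G"
    using sub by auto
  moreover have "pverts I = pverts G" using verts[OF assms(2)] verts[OF assms(3)] n by simp
  moreover have "k = 1"
  proof -
    \<comment> \<open>The number of bits suffices: only 1 has exactly one binary digit.\<close>
    have "length (map (bit k) [0..<floorlog 2 k]) = length (map (bit (1 :: nat)) [0..<floorlog 2 1])"
      using *(2) by simp
    then have f: "floorlog 2 k = 1" by (simp add: floorlog_def)
    then have "0 < k" by (cases "k = 0") (auto simp: floorlog_def)
    then show ?thesis using floorlog_bounds[of k 2] f by auto
  qed
  ultimately show ?thesis by simp
qed

lemma poly_nat_mono: "m \<le> n \<Longrightarrow> poly p m \<le> poly p (n :: nat)"
  by (induction p) (auto intro: add_mono mult_mono)

lemma tm_outputs_within_mono:
  assumes "tm_outputs_within M ws w t" "t \<le> t'"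
  shows "tm_outputs_within M ws w t'"
proof -
  let ?cf = "(tm_step M ^^ t) (tm_initial M ws)"
  have "fst ?cf = 1" using assms(1) by (auto simp: tm_outputs_within_def)
  then have "(tm_step M ^^ t') (tm_initial M ws) = ?cf"
    by (rule funpow_fixed_le[OF refl tm_step_halted assms(2)])
  then show ?thesis using assms(1) by (simp add: tm_outputs_within_def)
qed

theorem corollary3:
  shows "NP_hard_minimization encode_instance weakly_connected_digraphs
           shortest_paths max_closeness"
  unfolding NP_hard_minimization_def NP_hard_def
proof
  fix A assume "A \<in> NP"
  then obtain V and p :: "nat poly" where V: "poly_time 2 (\<lambda>ws. [V (ws ! 0) (ws ! 1)])"
    and A: "\<And>x. x \<in> A \<longleftrightarrow> (\<exists>u. length u \<le> poly p (length x) \<and> V x u)"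
    unfolding NP_def by blast
  from V obtain M and q :: "nat poly" where M: "wf_tm M" "2 \<le> num_tapes M"
    and out: "\<And>ws. length ws = 2 \<Longrightarrow>
      tm_outputs_within M ws [V (ws ! 0) (ws ! 1)] (poly q (sum_list (map length ws)))"
    unfolding poly_time_def by blast
  \<comment> \<open>The list depends on \<open>M\<close> only, so it is part of the program and not
    computed from the input.\<close>
  obtain ks where ks: "set ks = kinds M" "distinct ks"
    using finite_distinct_list[OF finite_kinds] by blast
  \<comment> \<open>Bounds the verifier's time on \<open>x\<close> with any certificate of
    admissible length, by a polynomial in the length of \<open>x\<close> alone.\<close>
  define r where "r = pcompose q ([:0, 1:] + p)"
  define R where "R x = poly r (length x)" for x :: "bool list"
  define P where "P x = poly p (length x)" for x :: "bool list"
  have tg: "tableau_graph M ks" using M ks by (simp add: tableau_graph_def)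
  define f where "f x = encode_instance (tableau_graph.graph M ks x (R x) (P x)) 1" for x
  \<comment> \<open>In this order: the position of the heads, the end of the certificate range, the
    number of times, the number of positions.\<close>
  define rps where "rps = [(5, smult 2 r), (6, smult 2 r + p), (7, r + 1), (8 :: nat, smult 4 r + 1)]"
  have "f x = grid ks (s 7) (s 8) (\<lambda>t p k. [True]) @ [False] @
    grid ks (s 7) (s 8) (\<lambda>t p k. grid ks (s 7) (s 8) (\<lambda>t' p' k'.
      [adjacent M x (s 5) (s 6) (s 7) (s 8) t p k t' p' k'])) @ [True]"
    if "s = set_polys rps (length x)" for x s
    unfolding that f_def tableau_graph.encode_graph[OF tg]
    by (simp add: rps_def set_polys_def R_def P_def)
  moreover note poly_time_emittable[OF emittable_encoding, of rps ks M]
  ultimately have "poly_time 1 (\<lambda>ws. f (ws ! 0))"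
    by (simp add: rps_def)
  moreover have "x \<in> A \<longleftrightarrow>
    f x \<in> decision_version encode_instance weakly_connected_digraphs shortest_paths max_closeness" for x
  proof -
    let ?G = "tableau_graph.graph M ks x (R x) (P x)"
    have outx: "tm_outputs_within M [x, u] [V x u] (R x)" if "length u \<le> P x" for u
    proof (rule tm_outputs_within_mono)
      show "tm_outputs_within M [x, u] [V x u] (poly q (length x + length u))"
        using out[of "[x, u]"] by simp
      show "poly q (length x + length u) \<le> R x"
        using that by (simp add: R_def r_def poly_pcompose P_def poly_nat_mono)
    qed
    have "x \<in> A \<longleftrightarrow> (\<exists>T. tableau M x (R x) (P x) T)"
      using A certificate_imp_tableau[where V = V, OF M outx] tableau_imp_certificate[where V = V, OF M outx] by (auto simp: P_def)
    also have "\<dots> \<longleftrightarrow> (\<exists>p \<in> shortest_paths ?G. max_closeness ?G p \<le> 1)"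
      using tableau_graph.central_path_iff_tableau[OF tg] by simp
    also have "\<dots> \<longleftrightarrow> f x \<in> decision_version encode_instance weakly_connected_digraphs shortest_paths max_closeness"
    proof
      assume "\<exists>p \<in> shortest_paths ?G. max_closeness ?G p \<le> 1"
      then show "f x \<in> decision_version encode_instance weakly_connected_digraphs shortest_paths max_closeness"
        using tableau_graph.graph_in_instances[OF tg] unfolding decision_version_def f_def one_enat_def by blast
    next
      assume "f x \<in> decision_version encode_instance weakly_connected_digraphs shortest_paths max_closeness"
      then obtain I k where I: "encode_instance I k = f x" "I \<in> weakly_connected_digraphs"
        "\<exists>p \<in> shortest_paths I. max_closeness I p \<le> enat k"
        unfolding decision_version_def by fastforce
      then have "I = ?G \<and> k = 1"
        using encode_instance_eq_1 tableau_graph.graph_in_instances[OF tg] unfolding f_def by blast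
      then show "\<exists>p \<in> shortest_paths ?G. max_closeness ?G p \<le> 1"
        using I(3) by (simp add: one_enat_def)
    qed
    finally show ?thesis .
  qed
  ultimately show "A \<le>\<^sub>p decision_version encode_instance weakly_connected_digraphs shortest_paths max_closeness"
    unfolding poly_reducible_def by blast
qed

end
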